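(* Let $f:X\to X$ be a continuum-wise expansive homeomorphism on a continuum $X$ with metric $d$, and let $\sigma\in\{u,s\}$. Suppose that $X$ contains a periodic $\sigma$-chaotic continuum $H$ of $f$. Put $g=f^{-1}$ if $\sigma=u$ and $g=f$ if $\sigma=s$. Then there exists a Cantor set $Z$ in $H$ such that: (1) $Z$ is vertically embedded to $V^\sigma(x;H)$ $(x\in H)$, i.e. no two distinct points of $Z$ belong to the same set $V^{\sigma}(x;H)$ with $x\in H$; (2) every finite tuple of points of $Z$ is an IE-tuple of $g$; (3) for all $k\in\mathbb N$, any $k$ distinct points $y_1,\dots,y_k\in Z$ and any points $z_1,\dots,z_k\in Z$, $$\liminf_{n\to\infty}\max\{d(g^{n}(y_i),z_i)\mid 1\le i\le k\}=0.$$
   Context: All maps are continuous; $\mathbb N=\{1,2,\dots\}$. A continuum is a compact connected metric space, nondegenerate if it has more than one point. A homeomorphism $f:X\to X$ of a compact metric space is continuum-wise expansive if there is $c>0$ such that for every nondegenerate subcontinuum $A$ of $X$ there is $n\in\mathbb Z$ with $\operatorname{diam} f^n(A)>c$. For a closed set $H\subset X$ let $C(H)$ be the set of nonempty closed connected subsets of $H$. For $x\in H$ put $V^s(x;H)=\{y\in H\mid \exists A\in C(H): x,y\in A,\ \lim_{n\to\infty}\operatorname{diam} f^n(A)=0\}$ and $V^u(x;H)=\{y\in H\mid \exists A\in C(H): x,y\in A,\ \lim_{n\to\infty}\operatorname{diam} f^{-n}(A)=0\}$. A subcontinuum $H$ of $X$ is a $\sigma$-chaotic continuum of $f$ ($\sigma=s,u$)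 if (1) for each $x\in H$, $V^\sigma(x;H)$ is dense in $H$, and (2) there is $\tau>0$ such that for each $x\in H$ and each neighborhood $U$ of $x$ in $X$ there is $y\in U\cap H$ with $\liminf_{n\to\infty}d(f^n(x),f^n(y))\ge\tau$ in case $\sigma=s$, or $\liminf_{n\to\infty}d(f^{-n}(x),f^{-n}(y))\ge\tau$ in case $\sigma=u$. $H$ is periodic if $f^n(H)=H$ for some $n\in\mathbb N$. Let $g:X\to X$ be a map. A set $I\subseteq\mathbb N$ has positive density if $\liminf_{n\to\infty}|I\cap\{1,\dots,n\}|/n>0$. A collection $\mathcal A$ of subsets of $X$ has an independence set with positive density (for $g$) if there is $I\subset\mathbb N$ with positive density such that for all finite $J\subseteq I$ and all $(Y_j)\in\prod_{j\in J}\mathcal A$ we have $\bigcap_{j\in J}g^{-j}(Y_j)\neq\emptyset$. A tuple $(x_1,\dots,x_n)$ of points of $X$ is an IE-tuple of $g$ if for all open sets $A_1,\dots,A_n$ containing $x_1,\dots,x_n$ respectively, the collection $\{A_1,\dots,A_n\}$ has an independence set with positive density. *)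

theory Defs
  imports "HOL-Analysis.Analysis"
begin

text \<open>The space is a subset X of a metric space type, carrying the restriction of \<open>dist\<close>;
  a self-map of X is a function on the type that is only ever applied to points of X.\<close>

definition continuum :: "'a::metric_space set \<Rightarrow> bool" where
  "continuum S \<longleftrightarrow> S \<noteq> {} \<and> compact S \<and> connected S"

definition subcontinuum :: "'a::metric_space set \<Rightarrow> 'a set \<Rightarrow> bool" where
  "subcontinuum X A \<longleftrightarrow> A \<subseteq> X \<and> continuum A"

definition nondegenerate :: "'a set \<Rightarrow> bool" where
  "nondegenerate S \<longleftrightarrow> (\<exists>x\<in>S. \<exists>y\<in>S. x \<noteq> y)"

definition self_homeomorphism :: "'a::metric_space set \<Rightarrow> ('a \<Rightarrow> 'a) \<Rightarrow> bool" where
  "self_homeomorphism X f \<longleftrightarrow> homeomorphism X X f (inv_into X f)"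

definition int_iterate :: "'a set \<Rightarrow> ('a \<Rightarrow> 'a) \<Rightarrow> int \<Rightarrow> 'a \<Rightarrow> 'a" where
  "int_iterate X f n =
     (if 0 \<le> n then f ^^ nat n else inv_into X f ^^ nat (- n))"

definition cw_expansive :: "'a::metric_space set \<Rightarrow> ('a \<Rightarrow> 'a) \<Rightarrow> bool" where
  "cw_expansive X f \<longleftrightarrow>
     (\<exists>c>0. \<forall>A. subcontinuum X A \<and> nondegenerate A \<longrightarrow>
        (\<exists>n::int. diameter (int_iterate X f n ` A) > c))"

datatype direction = Stable | Unstable

text \<open>The map whose forward iterates are \<open>f\<^sup>n\<close> for \<open>\<sigma> = s\<close> and \<open>f\<^sup>-\<^sup>n\<close> for \<open>\<sigma> = u\<close>;
  this is g in the theorem.\<close>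

fun dir_map :: "'a set \<Rightarrow> ('a \<Rightarrow> 'a) \<Rightarrow> direction \<Rightarrow> 'a \<Rightarrow> 'a" where
  "dir_map X f Stable = f"
| "dir_map X f Unstable = inv_into X f"

text \<open>\<open>C(H)\<close>, for closed \<open>H\<close>.\<close>

definition closed_connected_subsets :: "'a::metric_space set \<Rightarrow> 'a set set" where
  "closed_connected_subsets H = {A. A \<subseteq> H \<and> A \<noteq> {} \<and> closed A \<and> connected A}"

text \<open>\<open>V\<^sup>\<sigma>(x;H)\<close>.\<close>

definition V_set ::
  "'a::metric_space set \<Rightarrow> ('a \<Rightarrow> 'a) \<Rightarrow> direction \<Rightarrow> 'a \<Rightarrow> 'a set \<Rightarrow> 'a set" where
  "V_set X f \<sigma> x H =
     {y \<in> H. \<exists>A \<in> closed_connected_subsets H. x \<in> A \<and> y \<in> A \<and>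
        (\<lambda>n. diameter ((dir_map X f \<sigma> ^^ n) ` A)) \<longlonglongrightarrow> 0}"

definition chaotic_continuum ::
  "'a::metric_space set \<Rightarrow> ('a \<Rightarrow> 'a) \<Rightarrow> direction \<Rightarrow> 'a set \<Rightarrow> bool" where
  "chaotic_continuum X f \<sigma> H \<longleftrightarrow>
     subcontinuum X H \<and>
     (\<forall>x\<in>H. H \<subseteq> closure (V_set X f \<sigma> x H)) \<and>
     (\<exists>\<tau>>0. \<forall>x\<in>H. \<forall>U. openin (top_of_set X) U \<and> x \<in> U \<longrightarrow>
        (\<exists>y\<in>U \<inter> H.
           liminf (\<lambda>n. ereal (dist ((dir_map X f \<sigma> ^^ n) x) ((dir_map X f \<sigma> ^^ n) y)))
             \<ge> ereal \<tau>))"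

definition periodic_set :: "('a \<Rightarrow> 'a) \<Rightarrow> 'a set \<Rightarrow> bool" where
  "periodic_set f H \<longleftrightarrow> (\<exists>n\<ge>1. (f ^^ n) ` H = H)"

definition positive_density :: "nat set \<Rightarrow> bool" where
  "positive_density I \<longleftrightarrow>
     liminf (\<lambda>n. ereal (real (card (I \<inter> {1..n})) / real n)) > 0"

definition has_independence_set_pos_density ::
  "'a set \<Rightarrow> ('a \<Rightarrow> 'a) \<Rightarrow> 'a set set \<Rightarrow> bool" where
  "has_independence_set_pos_density X g \<A> \<longleftrightarrow>
     (\<exists>I \<subseteq> {1..}. positive_density I \<and>
        (\<forall>J Y. finite J \<and> J \<subseteq> I \<and> (\<forall>j\<in>J. Y j \<in> \<A>) \<longrightarrow>
           {x \<in> X. \<forall>j\<in>J. (g ^^ j) x \<in> Y j} \<noteq> {}))"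

definition IE_tuple :: "'a::metric_space set \<Rightarrow> ('a \<Rightarrow> 'a) \<Rightarrow> 'a list \<Rightarrow> bool" where
  "IE_tuple X g xs \<longleftrightarrow>
     (\<forall>As. length As = length xs \<and>
        (\<forall>i<length xs. openin (top_of_set X) (As ! i) \<and> xs ! i \<in> As ! i) \<longrightarrow>
        has_independence_set_pos_density X g (set As))"

text \<open>A Cantor set is a homeomorphic copy of the Cantor space; \<open>nat \<Rightarrow> bool\<close> carries the
  product of the discrete topologies.\<close>

definition Cantor_set :: "'a::metric_space set \<Rightarrow> bool" where
  "Cantor_set Z \<longleftrightarrow> Z homeomorphic (UNIV :: (nat \<Rightarrow> bool) set)"

definition vertically_embedded ::
  "'a::metric_space set \<Rightarrow> ('a \<Rightarrow> 'a) \<Rightarrow> direction \<Rightarrow> 'a set \<Rightarrow> 'a set \<Rightarrow> bool" where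
  "vertically_embedded X f \<sigma> H Z \<longleftrightarrow>
     (\<forall>x\<in>H. \<forall>y\<in>Z. \<forall>z\<in>Z. y \<in> V_set X f \<sigma> x H \<and> z \<in> V_set X f \<sigma> x H \<longrightarrow> y = z)"

end

theory Submission
  imports Defs
begin

text \<open>Put \<open>F = g\<^sup>m\<close> where \<open>g\<^sup>m(H) = H\<close>. Property (1) follows from (3): two points of \<open>Z\<close> in one
  set \<open>V\<^sup>\<sigma>(x;H)\<close> are asymptotic under \<open>g\<close>, while by (3) both return close to themselves at a common
  time. It remains to find, from two disjoint closed sets with an independence set of positive
  density for \<open>F\<close>, a Cantor scheme of closed sets of shrinking diameter such that each level again
  has an independence set of positive density and every map from one level to the previous one is
  realized by a late iterate of \<open>F\<close>. Shrinking the diameters rests on the Karpovsky--Milman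
  generalization of the Sauer--Shelah lemma.

  The first two sets come from the expansiveness: a nondegenerate continuum contracted by \<open>F\<close>
  grows to a definite diameter within bounded time under \<open>F\<^sup>-\<^sup>1\<close>, and then contains two such
  continua that are far apart. The resulting binary tree is turned into independent times by
  counting shattered sets.\<close>

subsection \<open>Full projections of sets of words\<close>

text \<open>The obstacle is to replace one of the closed sets by a small piece without losing
  independence. The piece visited at time j depends on the whole word that a point realizes, not
  only on the letter at j, so a given set of times need not receive one colour for all words.
  Counting resolves this: exponentially many words agree with one fixed colouring of the times, and
  such a set of words still projects onto all words over a positive proportion of the times.

  Densities are first measured in infinitely many finite windows, where every choice is finite and
  can be remade for each window; compactness yields one infinite set of times at the end. Sets are
  merely duplicated for the next level: their disjointness is a by-product of realizing all maps
  between levels, since one such map sends two given children into disjoint parents.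

  The shattering count runs backwards in time, because contracted continua grow under the inverse;
  reversing a finite window turns independence for the inverse into independence for
  \<open>F\<close>.\<close>

definition full_on :: "('j \<Rightarrow> 'i) set \<Rightarrow> 'i set \<Rightarrow> 'j set \<Rightarrow> bool" where
  "full_on S K J \<longleftrightarrow> (\<forall>w. w ` J \<subseteq> K \<longrightarrow> (\<exists>s\<in>S. \<forall>j\<in>J. s j = w j))"

text \<open>Deleting a coordinate \<open>j\<close> splits the count: a word of the projection has at
  most \<open>k - 1\<close> extensions, except that those in \<open>Ta\<close> have all
  \<open>k\<close>. A set full for \<open>Ta\<close> stays full for \<open>S\<close> after adding
  \<open>j\<close>, which lowers \<open>d\<close> by one. The weight \<open>t ^ d\<close> replaces
  the binomial sum of the classical bound, so that the induction only adds \<open>k - 1\<close>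
  times and \<open>t\<close> times the same power.\<close>

lemma Karpovsky_Milman:
  fixes t :: real
  assumes "finite J" "finite K" "K \<noteq> {}" "0 < t" "t \<le> 1"
    and "S \<subseteq> J \<rightarrow>\<^sub>E K"
    and "\<And>J'. J' \<subseteq> J \<Longrightarrow> full_on S K J' \<Longrightarrow> card J' \<le> d"
  shows "real (card S) * t ^ d \<le> (real (card K) - 1 + t) ^ card J"
  using assms(1,6,7)
proof (induction J arbitrary: S d rule: finite_induct)
  case empty
  then have "S \<subseteq> {\<lambda>x. undefined}" by auto
  then have "card S \<le> 1"
    by (metis card.empty card_mono finite.emptyI finite_insert is_singletonI is_singleton_altdef)
  then show ?case
    using assms(4,5) by (simp add: mult_le_one power_le_one)
next
  case (insert j J)
  define k where "k = card K"
  have k: "k \<ge> 1"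
    using assms(2,3) by (simp add: k_def Suc_leI card_gt_0_iff)
  define T where "T = (\<lambda>s. s(j := undefined)) ` S"
  define ext where "ext u = {y \<in> K. u(j := y) \<in> S}" for u
  define Ta where "Ta = {u \<in> T. ext u = K}"
  have finS: "finite S"
    using insert.prems(1) finite_PiE[of "insert j J" "\<lambda>_. K"] insert.hyps(1) assms(2)
    by (meson finite.insertI finite_subset)
  have TJ: "T \<subseteq> J \<rightarrow>\<^sub>E K"
    using insert.prems(1) insert.hyps(2) unfolding T_def
    by (fastforce simp: PiE_iff extensional_def)
  have finT: "finite T" by (simp add: T_def finS)
  have Tfull: "card J' \<le> d" if J': "J' \<subseteq> J" "full_on T K J'" for J'
  proof (rule insert.prems(2))
    show "J' \<subseteq> insert j J" using J'(1) by blast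
    show "full_on S K J'"
      unfolding full_on_def
    proof (intro allI impI)
      fix w assume "w ` J' \<subseteq> K"
      then obtain s where "s \<in> S" "\<forall>i\<in>J'. (s(j := undefined)) i = w i"
        using J'(2) unfolding full_on_def T_def by blast
      moreover have "j \<notin> J'" using J'(1) insert.hyps(2) by blast
      ultimately show "\<exists>s\<in>S. \<forall>i\<in>J'. s i = w i"
        by (metis fun_upd_other)
    qed
  qed
  have Tafull: "card J' + 1 \<le> d" if J': "J' \<subseteq> J" "full_on Ta K J'" for J'
  proof -
    have jJ: "j \<notin> J'" using J'(1) insert.hyps(2) by blast
    have "full_on S K (insert j J')"
      unfolding full_on_def
    proof (intro allI impI)
      fix w assume w: "w ` insert j J' \<subseteq> K"
      then obtain u where u: "u \<in> Ta" "\<forall>i\<in>J'. u i = w i"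
        using J'(2) unfolding full_on_def by blast
      then have "u(j := w j) \<in> S" using w by (auto simp: Ta_def ext_def)
      then show "\<exists>s\<in>S. \<forall>i\<in>insert j J'. s i = w i"
        using u jJ by (intro bexI[of _ "u(j := w j)"]) auto
    qed
    then have "card (insert j J') \<le> d"
      using insert.prems(2) J'(1) by (meson insert_mono)
    then show ?thesis
      using jJ finite_subset[OF J'(1) insert.hyps(1)] by simp
  qed
  have "card S \<le> card (Sigma T ext)"
  proof (rule card_inj_on_le)
    show "inj_on (\<lambda>s. (s(j := undefined), s j)) S"
      by (rule inj_onI) (metis fun_upd_triv fun_upd_upd prod.inject)
    show "(\<lambda>s. (s(j := undefined), s j)) ` S \<subseteq> Sigma T ext"
      using insert.prems(1) by (auto simp: T_def ext_def dest!: subsetD)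
    show "finite (Sigma T ext)"
      using finT assms(2) by (auto simp: ext_def)
  qed
  also have "\<dots> = (\<Sum>u\<in>T. card (ext u))"
    using finT assms(2) by (auto simp: ext_def card_SigmaI)
  also have "\<dots> \<le> (\<Sum>u\<in>T. (k - 1) + (if u \<in> Ta then 1 else 0))"
  proof (rule sum_mono)
    fix u assume "u \<in> T"
    have "ext u \<subseteq> K" by (auto simp: ext_def)
    show "card (ext u) \<le> (k - 1) + (if u \<in> Ta then 1 else 0)"
    proof (cases "ext u = K")
      case True
      then show ?thesis using k \<open>u \<in> T\<close> by (simp add: Ta_def k_def)
    next
      case False
      then have "card (ext u) < k"
        using psubset_card_mono[OF assms(2), of "ext u"] \<open>ext u \<subseteq> K\<close> by (auto simp: k_def)
      then show ?thesis by simp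
    qed
  qed
  also have "\<dots> = (k - 1) * card T + card Ta"
    using finT by (simp add: sum.distrib Ta_def flip: sum.inter_filter)
  finally have "real (card S) \<le> real ((k - 1) * card T + card Ta)"
    using of_nat_le_iff by blast
  also have "\<dots> = (real k - 1) * real (card T) + real (card Ta)"
    using k by (simp add: of_nat_diff)
  finally have "real (card S) * t ^ d
      \<le> ((real k - 1) * real (card T) + real (card Ta)) * t ^ d"
    using assms(4) by (intro mult_right_mono) auto
  then have 1: "real (card S) * t ^ d
      \<le> (real k - 1) * (real (card T) * t ^ d) + real (card Ta) * t ^ d"
    by (simp add: algebra_simps)
  have 2: "real (card T) * t ^ d \<le> (real k - 1 + t) ^ card J"
    using insert.IH[OF TJ Tfull] by (simp add: k_def)
  have 3: "real (card Ta) * t ^ d \<le> t * (real k - 1 + t) ^ card J"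
  proof (cases "Ta = {}")
    case True
    then show ?thesis using k assms(4) by simp
  next
    case False
    \<comment> \<open>A nonempty \<open>Ta\<close> makes \<open>{j}\<close> full for
      \<open>S\<close>, so \<open>d\<close> is positive and the induction hypothesis applies with
      its predecessor.\<close>
    then have "full_on Ta K {}" unfolding full_on_def by auto
    then have "d > 0"
      using Tafull[of "{}"] by simp
    then obtain d' where d': "d = Suc d'"
      using gr0_conv_Suc by blast
    have "real (card Ta) * t ^ d' \<le> (real (card K) - 1 + t) ^ card J"
    proof (rule insert.IH)
      show "Ta \<subseteq> J \<rightarrow>\<^sub>E K" using TJ by (auto simp: Ta_def)
      show "card J' \<le> d'" if "J' \<subseteq> J" "full_on Ta K J'" for J'
        using Tafull[OF that] d' by simp
    qed
    then show ?thesis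
      using assms(4) by (simp add: d' k_def mult.left_commute)
  qed
  have "(real k - 1) * (real (card T) * t ^ d) \<le> (real k - 1) * (real k - 1 + t) ^ card J"
    using 2 k by (intro mult_left_mono) auto
  with 1 3 have "real (card S) * t ^ d \<le> (real k - 1 + t) * (real k - 1 + t) ^ card J"
    by (simp add: distrib_right)
  then show ?case
    using insert.hyps by (simp add: k_def)
qed

text \<open>Double counting of pairs of a word \<open>w\<close> and a compatible colouring
  \<open>p\<close>: a word leaves the colour free at each position whose letter is not
  \<open>a\<close>, so the sum over words factors over the positions, the letter \<open>a\<close>
  contributing 1 and each other letter \<open>card C\<close>. The factor
  \<open>card C ^ card J\<close> stands for division by the number of colourings.\<close>

lemma averaging_over_colours:
  fixes col :: "('j \<Rightarrow> 'i) \<Rightarrow> 'j \<Rightarrow> 'c"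
  assumes "finite J" "finite K" "a \<in> K" "finite C" "C \<noteq> {}"
    and col: "\<And>w j. w \<in> J \<rightarrow>\<^sub>E K \<Longrightarrow> j \<in> J \<Longrightarrow> w j = a \<Longrightarrow> col w j \<in> C"
  shows "\<exists>p \<in> J \<rightarrow>\<^sub>E C. (1 + card C * (card K - 1)) ^ card J
           \<le> card C ^ card J * card {w \<in> J \<rightarrow>\<^sub>E K. \<forall>j\<in>J. w j = a \<longrightarrow> col w j = p j}"
proof (rule ccontr)
  let ?W = "J \<rightarrow>\<^sub>E K" and ?P = "J \<rightarrow>\<^sub>E C"
  let ?R = "\<lambda>w p. \<forall>j\<in>J. w j = a \<longrightarrow> col w j = p j"
  let ?M = "(1 + card C * (card K - 1)) ^ card J"
  have fin: "finite ?W" "finite ?P"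
    using assms by (simp_all add: finite_PiE)
  have "(\<Sum>p\<in>?P. card {w\<in>?W. ?R w p}) = (\<Sum>w\<in>?W. card {p\<in>?P. ?R w p})"
    using sum.swap_restrict[OF fin, of "\<lambda>_ _. 1::nat" ?R] by simp
  also have "\<dots> = (\<Sum>w\<in>?W. \<Prod>j\<in>J. if w j = a then 1 else card C)"
  proof (rule sum.cong[OF refl])
    fix w assume w: "w \<in> ?W"
    have "{p\<in>?P. ?R w p} = PiE J (\<lambda>j. if w j = a then {col w j} else C)"
    proof (intro set_eqI iffI)
      fix p assume "p \<in> {p\<in>?P. ?R w p}"
      then show "p \<in> PiE J (\<lambda>j. if w j = a then {col w j} else C)"
        by (simp add: PiE_iff)
    next
      fix p assume p: "p \<in> PiE J (\<lambda>j. if w j = a then {col w j} else C)"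
      have "p j \<in> C \<and> (w j = a \<longrightarrow> col w j = p j)" if "j \<in> J" for j
        using PiE_mem[OF p that] col[OF w that] by (cases "w j = a") auto
      then show "p \<in> {p\<in>?P. ?R w p}"
        using p by (simp add: PiE_iff)
    qed
    then show "card {p\<in>?P. ?R w p} = (\<Prod>j\<in>J. if w j = a then 1 else card C)"
      using assms(1) by (simp add: card_PiE if_distrib cong: if_cong)
  qed
  also have "\<dots> = (\<Prod>j\<in>J. \<Sum>y\<in>K. if y = a then 1 else card C)"
    using assms(1,2) by (subst prod_sum_PiE) auto
  also have "(\<Sum>y\<in>K. if y = a then 1 else card C) = 1 + card C * (card K - 1)"
    using assms(2,3) by (simp add: sum.remove)
  finally have *: "(\<Sum>p\<in>?P. card {w\<in>?W. ?R w p}) = ?M"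
    by simp
  assume "\<not> ?thesis"
  then have "(\<Sum>p\<in>?P. card C ^ card J * card {w\<in>?W. ?R w p}) < (\<Sum>p\<in>?P. ?M)"
    using assms(5) fin by (intro sum_strict_mono) (auto simp: PiE_eq_empty_iff)
  then show False
    using * assms(1) by (simp add: card_PiE flip: sum_distrib_left)
qed

text \<open>Averaging over colourings \<open>p\<close> of the positions with \<open>r\<close> colours leaves at least \<open>(k - 1 + 1/r)\<^sup>n\<close> of
  the \<open>k\<^sup>n\<close> words compatible with some \<open>p\<close>, exponentially more than the bound \<open>(k - 1 + t)\<^sup>n\<close> of
  Karpovsky and Milman for \<open>t = 1/(2r)\<close>.\<close>

lemma monochromatic_full_on:
  assumes "finite K" "a \<in> K" "finite C" "C \<noteq> {}"
  shows "\<exists>\<delta>::real>0. \<forall>J (col :: ('j \<Rightarrow> 'i) \<Rightarrow> 'j \<Rightarrow> 'c). finite J \<longrightarrow>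
           (\<forall>w\<in>J \<rightarrow>\<^sub>E K. \<forall>j\<in>J. w j = a \<longrightarrow> col w j \<in> C) \<longrightarrow>
           (\<exists>e\<in>C. \<exists>J'\<subseteq>J. \<delta> * real (card J) \<le> real (card J') \<and>
             full_on {w \<in> J \<rightarrow>\<^sub>E K. \<forall>j\<in>J'. w j = a \<longrightarrow> col w j = e} K J')"
proof -
  define k r where "k = real (card K)" and "r = real (card C)"
  define t where "t = 1 / (2 * r)"
  define \<rho> where "\<rho> = (k - 1 + 2 * t) / (k - 1 + t)"
  have k: "k \<ge> 1"
    using assms(1,2) by (metis One_nat_def Suc_leI card_gt_0_iff empty_iff k_def of_nat_1 of_nat_le_iff)
  have r: "r \<ge> 1"
    using assms(3,4) by (metis One_nat_def Suc_leI card_gt_0_iff r_def of_nat_1 of_nat_le_iff)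
  have t: "0 < t" "t \<le> 1 / 2"
    using r by (auto simp: t_def field_simps)
  have kt: "k - 1 + t > 0" using k t by simp
  have \<rho>: "\<rho> > 1"
    using kt t by (simp add: \<rho>_def)
  \<comment> \<open>Comparing the two exponentials gives \<open>d\<close> at least
    \<open>n * ln \<rho> / ln (1 / t)\<close>; the further division by \<open>r\<close> pays for
    keeping only the commonest colour of \<open>p\<close> on \<open>J1\<close>.\<close>
  define \<delta> where "\<delta> = ln \<rho> / ln (1 / t) / r"
  have lnt: "ln (1 / t) > 0"
    using t by (intro ln_gt_zero) (auto simp: field_simps)
  show ?thesis
  proof (intro exI[of _ \<delta>] conjI allI impI)
    show "\<delta> > 0"
      using \<rho> lnt r by (simp add: \<delta>_def)
    fix J :: "'j set" and col :: "('j \<Rightarrow> 'i) \<Rightarrow> 'j \<Rightarrow> 'c"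
    assume J: "finite J"
      and col: "\<forall>w\<in>J \<rightarrow>\<^sub>E K. \<forall>j\<in>J. w j = a \<longrightarrow> col w j \<in> C"
    define n where "n = card J"
    obtain p where p: "p \<in> J \<rightarrow>\<^sub>E C" and "(1 + card C * (card K - 1)) ^ card J
           \<le> card C ^ card J * card {w \<in> J \<rightarrow>\<^sub>E K. \<forall>j\<in>J. w j = a \<longrightarrow> col w j = p j}" (is "?l \<le> ?r")
      using averaging_over_colours[OF J assms(1,2,3,4), of col] col by blast
    define S where "S = {w \<in> J \<rightarrow>\<^sub>E K. \<forall>j\<in>J. w j = a \<longrightarrow> col w j = p j}"
    have "real ?l \<le> real ?r"
      using \<open>?l \<le> ?r\<close> of_nat_le_iff by blast
    moreover have "real ?l = (1 + r * (k - 1)) ^ n"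
      using k by (simp add: r_def k_def n_def of_nat_diff)
    moreover have "1 + r * (k - 1) = r * (k - 1 + 2 * t)"
      using r by (simp add: t_def field_simps)
    ultimately have "r ^ n * (k - 1 + 2 * t) ^ n \<le> r ^ n * real (card S)"
      by (simp add: S_def r_def n_def power_mult_distrib)
    then have S: "(k - 1 + 2 * t) ^ n \<le> real (card S)"
      using r by simp
    then have "card S > 0"
      using kt t by (smt (verit, ccfv_SIG) of_nat_0_less_iff zero_less_power)
    then have "S \<noteq> {}" by auto
    \<comment> \<open>A largest full set has size \<open>d\<close>, so the counting bound applies
      with this \<open>d\<close> and thereby bounds it from below.\<close>
    define \<D> where "\<D> = {J' \<in> Pow J. full_on S K J'}"
    have "finite \<D>" using J by (simp add: \<D>_def)
    moreover have "{} \<in> \<D>" using \<open>S \<noteq> {}\<close> by (auto simp: \<D>_def full_on_def)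
    ultimately obtain J1 where J1: "J1 \<in> \<D>" "\<And>J'. J' \<in> \<D> \<Longrightarrow> card J' \<le> card J1"
      using Max_in[of "card ` \<D>"] Max_ge[of "card ` \<D>"] by (metis empty_iff finite_imageI image_iff image_is_empty)
    have J1J: "J1 \<subseteq> J" and J1f: "full_on S K J1"
      using J1(1) by (auto simp: \<D>_def)
    define d where "d = card J1"
    have "real (card S) * t ^ d \<le> (k - 1 + t) ^ n"
      unfolding k_def n_def
    proof (rule Karpovsky_Milman[OF J assms(1)])
      show "S \<subseteq> J \<rightarrow>\<^sub>E K" by (auto simp: S_def)
      show "card J' \<le> d" if "J' \<subseteq> J" "full_on S K J'" for J'
        using J1(2) that by (simp add: \<D>_def d_def)
    qed (use assms t in auto)
    then have "(k - 1 + 2 * t) ^ n * t ^ d \<le> (k - 1 + t) ^ n"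
      using S t by (meson dual_order.trans mult_right_mono less_imp_le zero_less_power)
    then have "\<rho> ^ n * t ^ d \<le> 1"
      using kt by (simp add: \<rho>_def power_divide field_simps)
    then have "ln (\<rho> ^ n * t ^ d) \<le> 0"
      using \<rho> t by (subst ln_le_zero_iff) auto
    then have "n * ln \<rho> \<le> d * ln (1 / t)"
      using \<rho> t by (simp add: ln_mult ln_realpow ln_div)
    then have d: "ln \<rho> / ln (1 / t) * n \<le> d"
      using lnt by (simp add: field_simps)
    have "finite J1" using J J1J finite_subset by blast
    have "\<exists>e\<in>C. real d / r \<le> real (card {j \<in> J1. p j = e})"
    proof (rule ccontr)
      assume "\<not> ?thesis"
      then have "(\<Sum>e\<in>C. real (card {j \<in> J1. p j = e})) < (\<Sum>e\<in>C. real d / r)"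
        using assms(3,4) by (intro sum_strict_mono) auto
      also have "\<dots> = d" using r by (simp add: r_def)
      also have "d = card (\<Union>e\<in>C. {j \<in> J1. p j = e})"
        unfolding d_def using p J1J by (intro arg_cong[of _ _ card]) auto
      also have "\<dots> = (\<Sum>e\<in>C. card {j \<in> J1. p j = e})"
        using assms(3) \<open>finite J1\<close> by (intro card_UN_disjoint) auto
      finally show False by simp
    qed
    then obtain e where e: "e \<in> C" "real d / r \<le> real (card {j \<in> J1. p j = e})" by blast
    define J2 where "J2 = {j \<in> J1. p j = e}"
    have "\<delta> * real (card J) \<le> real (card J2)"
    proof -
      have "\<delta> * real (card J) = (ln \<rho> / ln (1 / t) * n) / r"
        by (simp add: \<delta>_def n_def)
      also have "\<dots> \<le> d / r" using d r by (intro divide_right_mono) auto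
      finally show ?thesis using e(2) by (simp add: J2_def)
    qed
    moreover have "full_on {w \<in> J \<rightarrow>\<^sub>E K. \<forall>j\<in>J2. w j = a \<longrightarrow> col w j = e} K J2"
      unfolding full_on_def
    proof (intro allI impI)
      fix w assume w: "w ` J2 \<subseteq> K"
      \<comment> \<open>Fullness is known on \<open>J1\<close>, so a word on \<open>J2\<close> is
        first completed by some letter of \<open>K\<close>.\<close>
      define w' where "w' j = (if j \<in> J2 then w j else a)" for j
      have "w' ` J1 \<subseteq> K" using w assms(2) by (auto simp: w'_def)
      then obtain s where s: "s \<in> S" "\<forall>j\<in>J1. s j = w' j"
        using J1f unfolding full_on_def by blast
      then have "\<forall>j\<in>J2. s j = w j" by (auto simp: J2_def w'_def)
      moreover have "\<forall>j\<in>J2. s j = a \<longrightarrow> col s j = e"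
        using s(1) J1J by (auto simp: S_def J2_def)
      ultimately show "\<exists>s\<in>{w \<in> J \<rightarrow>\<^sub>E K. \<forall>j\<in>J2. w j = a \<longrightarrow> col w j = e}. \<forall>j\<in>J2. s j = w j"
        using s(1) by (auto simp: S_def)
    qed
    moreover have "J2 \<subseteq> J" using J1J by (auto simp: J2_def)
    ultimately show "\<exists>e\<in>C. \<exists>J'\<subseteq>J. \<delta> * real (card J) \<le> real (card J') \<and>
        full_on {w \<in> J \<rightarrow>\<^sub>E K. \<forall>j\<in>J'. w j = a \<longrightarrow> col w j = e} K J'"
      using e(1) by blast
  qed
qed

subsection \<open>Independence along sets of positive density\<close>

definition indep_on :: "'b set \<Rightarrow> ('b \<Rightarrow> 'b) \<Rightarrow> ('i \<Rightarrow> 'b set) \<Rightarrow> 'i set \<Rightarrow> nat set \<Rightarrow> bool" where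
  "indep_on H F A K J \<longleftrightarrow> (\<forall>w. w ` J \<subseteq> K \<longrightarrow> (\<exists>x\<in>H. \<forall>j\<in>J. (F ^^ j) x \<in> A (w j)))"

text \<open>A positive proportion in infinitely many windows, with a new set of times for each of
  them: this finitary form survives the choices made below. Families are indexed, so that several
  letters may carry the same set.\<close>

definition dense_indep :: "'b set \<Rightarrow> ('b \<Rightarrow> 'b) \<Rightarrow> ('i \<Rightarrow> 'b set) \<Rightarrow> 'i set \<Rightarrow> bool" where
  "dense_indep H F A K \<longleftrightarrow> (\<exists>c>0. \<exists>\<^sub>F n in sequentially.
     \<exists>J\<subseteq>{1..n}. c * real n \<le> real (card J) \<and> indep_on H F A K J)"

lemma indep_onD:
  assumes "indep_on H F A K J" "w ` J \<subseteq> K"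
  obtains x where "x \<in> H" "\<And>j. j \<in> J \<Longrightarrow> (F ^^ j) x \<in> A (w j)"
  using assms unfolding indep_on_def by blast

lemma indep_on_subset:
  assumes "indep_on H F A K J" "J' \<subseteq> J" "K \<noteq> {}"
  shows "indep_on H F A K J'"
  unfolding indep_on_def
proof (intro allI impI)
  fix w assume w: "w ` J' \<subseteq> K"
  obtain a where "a \<in> K" using assms(3) by blast
  define w' where "w' j = (if j \<in> J' then w j else a)" for j
  have "w' ` J \<subseteq> K" using w \<open>a \<in> K\<close> by (auto simp: w'_def)
  then obtain x where x: "x \<in> H" "\<And>j. j \<in> J \<Longrightarrow> (F ^^ j) x \<in> A (w' j)"
    using assms(1) indep_onD by metis
  then show "\<exists>x\<in>H. \<forall>j\<in>J'. (F ^^ j) x \<in> A (w j)"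
    using assms(2) by (metis subsetD w'_def)
qed

lemma indep_on_reindex:
  assumes "indep_on H F A K J" "h ` K' \<subseteq> K" "\<And>i. i \<in> K' \<Longrightarrow> A (h i) \<subseteq> B i"
  shows "indep_on H F B K' J"
  unfolding indep_on_def
proof (intro allI impI)
  fix w assume w: "w ` J \<subseteq> K'"
  then have "(h \<circ> w) ` J \<subseteq> K" using assms(2) by auto
  then obtain x where "x \<in> H" "\<And>j. j \<in> J \<Longrightarrow> (F ^^ j) x \<in> A ((h \<circ> w) j)"
    using assms(1) indep_onD by metis
  then show "\<exists>x\<in>H. \<forall>j\<in>J. (F ^^ j) x \<in> B (w j)"
    using w assms(3) by (metis comp_apply image_subset_iff subsetD)
qed

text \<open>A word over the new letters is read as a word over the old ones, so \<open>h\<close>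
  need not be injective. This serves both to duplicate the sets for a new level and to treat tuples
  with repeated points.\<close>

lemma dense_indep_reindex:
  assumes "dense_indep H F A K" "h ` K' \<subseteq> K" "\<And>i. i \<in> K' \<Longrightarrow> A (h i) \<subseteq> B i"
  shows "dense_indep H F B K'"
proof -
  have *: "indep_on H F B K' J" if "indep_on H F A K J" for J
    by (rule indep_on_reindex[OF that assms(2)]) (rule assms(3))
  obtain c where c: "c > 0" and f: "\<exists>\<^sub>F n in sequentially.
     \<exists>J\<subseteq>{1..n}. c * real n \<le> real (card J) \<and> indep_on H F A K J"
    using assms(1) unfolding dense_indep_def by blast
  have "\<exists>\<^sub>F n in sequentially.
     \<exists>J\<subseteq>{1..n}. c * real n \<le> real (card J) \<and> indep_on H F B K' J"
  proof (rule frequently_elim1[OF f])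
    fix n assume "\<exists>J\<subseteq>{1..n}. c * real n \<le> real (card J) \<and> indep_on H F A K J"
    then obtain J where "J \<subseteq> {1..n}" "c * real n \<le> real (card J)" "indep_on H F A K J"
      by blast
    then show "\<exists>J\<subseteq>{1..n}. c * real n \<le> real (card J) \<and> indep_on H F B K' J"
      by (intro exI[of _ J] conjI *)
  qed
  then show ?thesis
    unfolding dense_indep_def using c by blast
qed

lemma dense_indep_nonempty:
  assumes "dense_indep H F A K" "i \<in> K"
  shows "A i \<noteq> {}"
proof -
  obtain c where c: "c > 0" and f: "\<exists>\<^sub>F n in sequentially.
     \<exists>J\<subseteq>{1..n}. c * real n \<le> real (card J) \<and> indep_on H F A K J"
    using assms(1) unfolding dense_indep_def by blast
  obtain n J where "n \<ge> 1" "c * real n \<le> real (card J)" "indep_on H F A K J"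
    using f unfolding frequently_sequentially by blast
  moreover from this c have "0 < c * real n" by simp
  ultimately have "J \<noteq> {}" by auto
  then obtain j where "j \<in> J" by blast
  have "(\<lambda>_. i) ` J \<subseteq> K" using assms(2) by auto
  from indep_onD[OF \<open>indep_on H F A K J\<close> this]
  show ?thesis using \<open>j \<in> J\<close> by blast
qed

text \<open>Each word chooses a point realizing it, and this point colours the times of the letter
  \<open>a\<close> by the piece of the cover that it visits then. On a set of times where one colour
  suffices for all words, the piece of that colour can replace the whole set.\<close>

lemma dense_indep_refine:
  fixes K :: "'i set" and C :: "'c set"
  assumes "dense_indep H F A K" "finite K" "a \<in> K" "finite C"
    and cover: "A a \<subseteq> (\<Union>e\<in>C. D e)"
  shows "\<exists>e\<in>C. dense_indep H F (A(a := A a \<inter> D e)) K"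
proof -
  obtain c where c: "c > 0" and f: "\<exists>\<^sub>F n in sequentially.
     \<exists>J\<subseteq>{1..n}. c * real n \<le> real (card J) \<and> indep_on H F A K J"
    using assms(1) unfolding dense_indep_def by blast
  have "C \<noteq> {}" using dense_indep_nonempty[OF assms(1,3)] cover by auto
  obtain \<delta> :: real where \<delta>: "\<delta> > 0" and full:
    "\<forall>J (col :: (nat \<Rightarrow> 'i) \<Rightarrow> nat \<Rightarrow> 'c). finite J \<longrightarrow>
        (\<forall>w\<in>J \<rightarrow>\<^sub>E K. \<forall>j\<in>J. w j = a \<longrightarrow> col w j \<in> C) \<longrightarrow>
           (\<exists>e\<in>C. \<exists>J'\<subseteq>J. \<delta> * real (card J) \<le> real (card J') \<and>
             full_on {w \<in> J \<rightarrow>\<^sub>E K. \<forall>j\<in>J'. w j = a \<longrightarrow> col w j = e} K J')"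
    using monochromatic_full_on[OF assms(2,3,4) \<open>C \<noteq> {}\<close>] by blast
  have "\<exists>\<^sub>F n in sequentially. \<exists>e\<in>C. \<exists>J\<subseteq>{1..n}. (\<delta> * c) * real n \<le> real (card J) \<and>
      indep_on H F (A(a := A a \<inter> D e)) K J"
    using f
  proof (rule frequently_elim1)
    fix n assume "\<exists>J\<subseteq>{1..n}. c * real n \<le> real (card J) \<and> indep_on H F A K J"
    then obtain J where J: "J \<subseteq> {1..n}" "c * real n \<le> real (card J)" "indep_on H F A K J"
      by blast
    have "\<exists>x\<in>H. \<forall>j\<in>J. (F ^^ j) x \<in> A (w j)" if "w \<in> J \<rightarrow>\<^sub>E K" for w
      using J(3) that unfolding indep_on_def by blast
    then obtain x where x: "\<And>w. w \<in> J \<rightarrow>\<^sub>E K \<Longrightarrow> x w \<in> H"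
      "\<And>w j. w \<in> J \<rightarrow>\<^sub>E K \<Longrightarrow> j \<in> J \<Longrightarrow> (F ^^ j) (x w) \<in> A (w j)"
      by metis
    define col where "col w j = (SOME e. e \<in> C \<and> (F ^^ j) (x w) \<in> D e)" for w j
    have col: "col w j \<in> C \<and> (F ^^ j) (x w) \<in> D (col w j)"
      if "w \<in> J \<rightarrow>\<^sub>E K" "j \<in> J" "w j = a" for w j
      unfolding col_def by (rule someI_ex) (use x(2)[OF that(1,2)] that(3) cover in auto)
    have "finite J" using J(1) finite_subset by blast
    then obtain e J' where e: "e \<in> C" and J': "J' \<subseteq> J" "\<delta> * real (card J) \<le> real (card J')"
      "full_on {w \<in> J \<rightarrow>\<^sub>E K. \<forall>j\<in>J'. w j = a \<longrightarrow> col w j = e} K J'"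
      using full[rule_format, of J col] col by blast
    have "indep_on H F (A(a := A a \<inter> D e)) K J'"
      unfolding indep_on_def
    proof (intro allI impI)
      fix w assume "w ` J' \<subseteq> K"
      then obtain s where s: "s \<in> J \<rightarrow>\<^sub>E K" "\<forall>j\<in>J'. s j = a \<longrightarrow> col s j = e" "\<forall>j\<in>J'. s j = w j"
        using J'(3) unfolding full_on_def by blast
      have "(F ^^ j) (x s) \<in> (A(a := A a \<inter> D e)) (w j)" if "j \<in> J'" for j
        using col[OF s(1)] x(2)[OF s(1)] that J'(1) s(2,3) by (cases "w j = a") force+
      then show "\<exists>x\<in>H. \<forall>j\<in>J'. (F ^^ j) x \<in> (A(a := A a \<inter> D e)) (w j)"
        using x(1)[OF s(1)] by blast
    qed
    moreover have "\<delta> * c * real n \<le> real (card J')"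
    proof -
      have "\<delta> * c * real n \<le> \<delta> * real (card J)"
        using J(2) \<delta> by (simp add: mult.assoc)
      then show ?thesis using J'(2) by simp
    qed
    ultimately show "\<exists>e\<in>C. \<exists>J\<subseteq>{1..n}. (\<delta> * c) * real n \<le> real (card J) \<and>
      indep_on H F (A(a := A a \<inter> D e)) K J"
      using e J'(1) J(1) by (meson subset_trans)
  qed
  \<comment> \<open>The colour depends on the window; one of finitely many colours recurs in
    infinitely many windows.\<close>
  then have "\<exists>e\<in>C. \<exists>\<^sub>F n in sequentially. \<exists>J\<subseteq>{1..n}. (\<delta> * c) * real n \<le> real (card J) \<and>
      indep_on H F (A(a := A a \<inter> D e)) K J"
    by (rule frequently_bex_finite[OF assms(4)])
  then show ?thesis
    unfolding dense_indep_def using \<delta> c by (meson mult_pos_pos)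
qed

lemma dense_indep_small:
  fixes H :: "'b::metric_space set"
  assumes "dense_indep H F A K" "finite K" "compact H" "\<epsilon> > 0"
    and "\<And>i. i \<in> K \<Longrightarrow> A i \<subseteq> H \<and> closed (A i)"
  shows "\<exists>B. dense_indep H F B K \<and> (\<forall>i\<in>K. B i \<subseteq> A i \<and> closed (B i) \<and>
           (\<forall>x\<in>B i. \<forall>y\<in>B i. dist x y \<le> \<epsilon>))"
proof -
  obtain C where C: "finite C" "C \<subseteq> H" "H \<subseteq> (\<Union>e\<in>C. cball e (\<epsilon>/2))"
  proof -
    have cov: "H \<subseteq> (\<Union>e\<in>H. ball e (\<epsilon>/2))" using assms(4) by auto
    obtain C where "C \<subseteq> H" "finite C" "H \<subseteq> (\<Union>e\<in>C. ball e (\<epsilon>/2))"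
      by (rule compactE_image[OF assms(3) _ cov]) (rule open_ball, rule that)
    have "(\<Union>e\<in>C. ball e (\<epsilon>/2)) \<subseteq> (\<Union>e\<in>C. cball e (\<epsilon>/2))"
      by (intro UN_mono ball_subset_cball order_refl)
    with \<open>H \<subseteq> (\<Union>e\<in>C. ball e (\<epsilon>/2))\<close> have "H \<subseteq> (\<Union>e\<in>C. cball e (\<epsilon>/2))"
      by (rule subset_trans)
    then show thesis by (rule that[OF \<open>finite C\<close> \<open>C \<subseteq> H\<close>])
  qed
  \<comment> \<open>Each refinement touches one letter only, so the letters of \<open>L\<close>
    already treated keep their small sets.\<close>
  have "\<exists>B. dense_indep H F B K \<and> (\<forall>i\<in>K. B i \<subseteq> A i \<and> closed (B i)) \<and>
     (\<forall>i\<in>L. \<forall>x\<in>B i. \<forall>y\<in>B i. dist x y \<le> \<epsilon>)" if "finite L" "L \<subseteq> K" for L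
    using that
  proof (induction L rule: finite_induct)
    case empty
    then show ?case using assms(1,5) by (intro exI[of _ A]) auto
  next
    case (insert a L)
    then obtain B where B: "dense_indep H F B K" "\<forall>i\<in>K. B i \<subseteq> A i \<and> closed (B i)"
      "\<forall>i\<in>L. \<forall>x\<in>B i. \<forall>y\<in>B i. dist x y \<le> \<epsilon>" by auto
    have aK: "a \<in> K" using insert.prems by simp
    have "B a \<subseteq> (\<Union>e\<in>C. cball e (\<epsilon>/2))"
      using B(2) assms(5) C(3) aK by (meson subset_trans)
    then obtain e where e: "e \<in> C" "dense_indep H F (B(a := B a \<inter> cball e (\<epsilon>/2))) K"
      using dense_indep_refine[OF B(1) assms(2) aK C(1)] by blast
    have "dist x y \<le> \<epsilon>" if "x \<in> cball e (\<epsilon>/2)" "y \<in> cball e (\<epsilon>/2)" for x y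
      using that dist_triangle3[of x y e] by simp
    then have "\<forall>i\<in>insert a L. \<forall>x\<in>(B(a := B a \<inter> cball e (\<epsilon>/2))) i.
        \<forall>y\<in>(B(a := B a \<inter> cball e (\<epsilon>/2))) i. dist x y \<le> \<epsilon>"
      using B(3) by auto
    moreover have "\<forall>i\<in>K. (B(a := B a \<inter> cball e (\<epsilon>/2))) i \<subseteq> A i \<and>
        closed ((B(a := B a \<inter> cball e (\<epsilon>/2))) i)"
      using B(2) aK by (auto simp: closed_Int)
    ultimately show ?case
      using e(2) by blast
  qed
  from this[OF assms(2) order_refl] show ?thesis by blast
qed

text \<open>Restricting to one residue class modulo \<open>D > m\<close> makes \<open>J'\<close> and \<open>J' + m\<close> disjoint, so that the
  letters at times \<open>j\<close> and \<open>j + m\<close> can be prescribed independently.\<close>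

lemma dense_indep_shift:
  assumes "dense_indep H F B K" "\<phi> ` K \<subseteq> K" "K \<noteq> {}"
  shows "\<exists>n\<ge>b. dense_indep H F (\<lambda>i. {x \<in> B i. (F ^^ n) x \<in> B (\<phi> i)}) K"
proof -
  obtain c where c: "c > 0" and f: "\<exists>\<^sub>F n in sequentially.
     \<exists>J\<subseteq>{1..n}. c * real n \<le> real (card J) \<and> indep_on H F B K J"
    using assms(1) unfolding dense_indep_def by blast
  \<comment> \<open>The successor makes every admissible shift positive, hence not divisible by
    \<open>D\<close>.\<close>
  define b' where "b' = Suc b"
  \<comment> \<open>A block of length \<open>D\<close> contains at most \<open>b'\<close> times
    without a partner, so \<open>D \<ge> 2 * b' / c\<close> limits their number to
    \<open>c * n / 2\<close> up to one more block, which \<open>n \<ge> 4 * b' / c\<close> absorbs.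
    Of the remaining \<open>c * n / 4\<close> times, one of at most \<open>D * D\<close> pairs of a
    shift and a residue receives the share \<open>c' * n\<close>.\<close>
  define D where "D = nat \<lceil>2 * b' / c\<rceil>"
  have D: "2 * b' / c \<le> D" by (simp add: D_def real_nat_ceiling_ge)
  moreover have "2 * b' / c > 0" using c by (simp add: b'_def)
  ultimately have D0: "D > 0" by (simp add: D_def)
  define c' where "c' = c / (4 * D * D)"
  have c': "c' > 0" using c D0 by (simp add: c'_def)
  define B' where "B' n i = {x \<in> B i. (F ^^ n) x \<in> B (\<phi> i)}" for n i
  have ev: "\<forall>\<^sub>F n in sequentially. 4 * b' / c \<le> real n"
    by (intro eventually_sequentiallyI[of "nat \<lceil>4 * b' / c\<rceil>"]) linarith
  have "\<exists>\<^sub>F n in sequentially. \<exists>m\<in>{b..<D}. \<exists>J\<subseteq>{1..n}. c' * real n \<le> real (card J) \<and>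
      indep_on H F (B' m) K J"
    using frequently_eventually_frequently[OF f ev]
  proof (rule frequently_elim1)
    fix n assume "(\<exists>J\<subseteq>{1..n}. c * real n \<le> real (card J) \<and> indep_on H F B K J) \<and> 4 * b' / c \<le> real n"
    then obtain J where J: "J \<subseteq> {1..n}" "c * real n \<le> real (card J)" "indep_on H F B K J"
      and n: "4 * b' / c \<le> real n"
      by blast
    have finJ: "finite J" using J(1) finite_subset by blast
    define G where "G = (\<Union>(m,\<rho>)\<in>{b'..<D} \<times> {..<D}. {j\<in>J. j + m \<in> J \<and> j mod D = \<rho>})"
    define Bd where "Bd = {j\<in>J. \<forall>m\<in>{b'..<D}. j + m \<notin> J}"
    have "J \<subseteq> G \<union> Bd" using D0 by (auto simp: G_def Bd_def)
    moreover have "finite G" "finite Bd"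
      using finJ by (auto simp: G_def Bd_def)
    ultimately have JGB: "card J \<le> card G + card Bd"
      using card_Un_le[of G Bd] card_mono[of "G \<union> Bd" J] by simp
    have "Bd \<subseteq> (\<Union>q\<in>{..n div D}. {j\<in>Bd. j div D = q})"
      using J(1) by (auto simp: Bd_def div_le_mono)
    then have "card Bd \<le> card (\<Union>q\<in>{..n div D}. {j\<in>Bd. j div D = q})"
      using \<open>finite Bd\<close> by (intro card_mono) auto
    also have "\<dots> \<le> (\<Sum>q\<in>{..n div D}. card {j\<in>Bd. j div D = q})"
      by (intro card_UN_le) auto
    also have "\<dots> \<le> (\<Sum>q\<in>{..n div D}. b')"
    proof (rule sum_mono)
      fix q
      show "card {j\<in>Bd. j div D = q} \<le> b'"
      proof (cases "{j\<in>Bd. j div D = q} = {}")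
        case True then show ?thesis by (metis card.empty zero_le)
      next
        case False
        define j0 where "j0 = Min {j\<in>Bd. j div D = q}"
        have fq: "finite {j\<in>Bd. j div D = q}" using \<open>finite Bd\<close> by simp
        have j0: "j0 \<in> Bd" "j0 div D = q"
          using Min_in[OF fq False] by (auto simp: j0_def)
        \<comment> \<open>Two members of \<open>Bd\<close> in one block are less than
          \<open>D\<close> apart; were they at least \<open>b'\<close> apart, the later one would be
          a partner of the earlier.\<close>
        have "{j\<in>Bd. j div D = q} \<subseteq> {j0..<j0 + b'}"
        proof
          fix j assume j: "j \<in> {j\<in>Bd. j div D = q}"
          then have "j0 \<le> j" using fq by (simp add: j0_def)
          have "j div D = j0 div D" using j j0 by simp
          then have "j = j0 div D * D + j mod D"
            by (metis div_mult_mod_eq)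
          moreover have "j0 div D * D \<le> j0" by simp
          ultimately have "j < j0 + D"
            using mod_less_divisor[OF D0, of j] by linarith
          show "j \<in> {j0..<j0 + b'}"
          proof (rule ccontr)
            assume "j \<notin> {j0..<j0 + b'}"
            then have "j - j0 \<in> {b'..<D}" using \<open>j0 \<le> j\<close> \<open>j < j0 + D\<close> by auto
            then have "j0 + (j - j0) \<notin> J" using j0(1) unfolding Bd_def by blast
            then show False using j \<open>j0 \<le> j\<close> by (simp add: Bd_def)
          qed
        qed
        then show ?thesis
          using card_mono[of "{j0..<j0 + b'}"] by fastforce
      qed
    qed
    also have "\<dots> = b' * (n div D) + b'" by simp
    finally have "real (card Bd) \<le> b' * real (n div D) + b'"
      by (metis of_nat_add of_nat_le_iff of_nat_mult)
    also have "b' * real (n div D) \<le> b' * (n / D)"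
      by (intro mult_left_mono of_nat_div_le_of_nat) auto
    also have "b' * (n / D) \<le> c * n / 2"
    proof -
      have "2 * b' \<le> D * c" using D c by (simp add: field_simps)
      then have "2 * real b' * n \<le> D * c * n" by (intro mult_right_mono) auto
      then show ?thesis using D0 by (simp add: field_simps)
    qed
    also have "real b' \<le> c * n / 4" using n c by (simp add: field_simps)
    finally have "real (card Bd) \<le> 3 * (c * n) / 4" by simp
    then have G: "c * n / 4 \<le> card G" using JGB J(2) by simp
    have "\<exists>m\<in>{b'..<D}. \<exists>\<rho>\<in>{..<D}. c' * n \<le> card {j\<in>J. j + m \<in> J \<and> j mod D = \<rho>}"
    proof (rule ccontr)
      let ?X = "{b'..<D} \<times> {..<D}"
      let ?f = "\<lambda>(m,\<rho>). {j\<in>J. j + m \<in> J \<and> j mod D = \<rho>}"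
      assume neg: "\<not> ?thesis"
      have "0 < 4 * b' / c" using c by (simp add: b'_def)
      then have "n > 0" using n by (metis less_le_trans of_nat_0_less_iff)
      then have "0 < c * n / 4" using c by simp
      then have "G \<noteq> {}" using G by auto
      then have ne: "?X \<noteq> {}" unfolding G_def by auto
      have "real (card G) \<le> (\<Sum>x\<in>?X. card (?f x))"
        unfolding G_def of_nat_le_iff by (intro card_UN_le) auto
      also have "\<dots> = (\<Sum>x\<in>?X. real (card (?f x)))" by simp
      also have "\<dots> < (\<Sum>x\<in>?X. c' * n)"
        using neg ne by (intro sum_strict_mono) (auto simp: not_le)
      also have "\<dots> = card ?X * (c' * n)" by simp
      also have "\<dots> \<le> (D * D) * (c' * n)"
        using c' by (intro mult_right_mono) (auto simp: card_cartesian_product intro!: mult_right_mono)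
      also have "\<dots> = c * n / 4" using D0 by (simp add: c'_def)
      finally show False using G by simp
    qed
    then obtain m \<rho> where m: "m \<in> {b'..<D}"
      and card: "c' * n \<le> card {j\<in>J. j + m \<in> J \<and> j mod D = \<rho>}" by blast
    define J' where "J' = {j\<in>J. j + m \<in> J \<and> j mod D = \<rho>}"
    have disj: "j + m \<notin> J'" if "j \<in> J'" for j
    proof
      assume "j + m \<in> J'"
      then have "(j + m) mod D = j mod D" using that by (simp add: J'_def)
      then have "D dvd m" by (simp add: mod_eq_dvd_iff_nat)
      then show False using m by (auto simp: b'_def dest: dvd_imp_le)
    qed
    have "indep_on H F (B' m) K J'"
      unfolding indep_on_def
    proof (intro allI impI)
      fix w assume w: "w ` J' \<subseteq> K"
      obtain a where "a \<in> K" using assms(3) by blast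
      \<comment> \<open>The letter required after the shift is written at time \<open>j + m\<close>;
        times of neither kind get the default letter \<open>a\<close>.\<close>
      define w' where "w' i = (if i \<in> J' then w i else if i - m \<in> J' then \<phi> (w (i - m)) else a)" for i
      have "w' ` J \<subseteq> K" using w assms(2) \<open>a \<in> K\<close> by (auto simp: w'_def image_subset_iff)
      then obtain x where x: "x \<in> H" "\<And>j. j \<in> J \<Longrightarrow> (F ^^ j) x \<in> B (w' j)"
        using J(3) indep_onD by metis
      have "(F ^^ j) x \<in> B' m (w j)" if "j \<in> J'" for j
      proof -
        have "(F ^^ m) ((F ^^ j) x) = (F ^^ (j + m)) x"
          by (metis funpow_add comp_apply add.commute)
        moreover have "(F ^^ (j + m)) x \<in> B (w' (j + m))" "(F ^^ j) x \<in> B (w' j)"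
          using that by (auto intro!: x(2) simp: J'_def)
        ultimately show ?thesis using that disj[OF that] by (simp add: B'_def w'_def)
      qed
      then show "\<exists>x\<in>H. \<forall>j\<in>J'. (F ^^ j) x \<in> B' m (w j)" using x(1) by blast
    qed
    moreover have "J' \<subseteq> {1..n}" using J(1) by (auto simp: J'_def)
    moreover have "m \<in> {b..<D}" using m by (simp add: b'_def)
    ultimately show "\<exists>m\<in>{b..<D}. \<exists>J\<subseteq>{1..n}. c' * real n \<le> real (card J) \<and> indep_on H F (B' m) K J"
      using card unfolding J'_def[symmetric] by blast
  qed
  then have "\<exists>m\<in>{b..<D}. \<exists>\<^sub>F n in sequentially. \<exists>J\<subseteq>{1..n}. c' * real n \<le> real (card J) \<and>
      indep_on H F (B' m) K J"
    by (intro frequently_bex_finite) auto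
  then obtain m where "m \<in> {b..<D}" "dense_indep H F (B' m) K"
    unfolding dense_indep_def using c' by blast
  then show ?thesis
    unfolding B'_def by auto
qed

section \<open>Iterates, and the passage from finite windows to one infinite set of times\<close>

lemma funpow_invariant:
  assumes "F ` H \<subseteq> H" "x \<in> H"
  shows "(F ^^ n) x \<in> H"
  using assms by (induction n) auto

lemma funpow_left_inverse:
  assumes "g ` X \<subseteq> X" "\<And>x. x \<in> X \<Longrightarrow> g' (g x) = x" "x \<in> X"
  shows "(g' ^^ n) ((g ^^ n) x) = x"
  using assms(3)
proof (induction n)
  case (Suc n)
  then have "(g' ^^ n) (g' (g ((g ^^ n) x))) = x"
    using assms(2) funpow_invariant[OF assms(1)] by simp
  then show ?case by (simp add: funpow_swap1)
qed simp

lemma continuous_on_funpow: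
  assumes "F ` H \<subseteq> H" "continuous_on H F"
  shows "continuous_on H (F ^^ n)"
proof (induction n)
  case 0
  then show ?case by (simp add: continuous_on_id')
next
  case (Suc n)
  have "(F ^^ n) ` H \<subseteq> H" using funpow_invariant[OF assms(1)] by blast
  then have "continuous_on ((F ^^ n) ` H) F"
    using assms(2) continuous_on_subset by blast
  with Suc show ?case
    using continuous_on_compose by fastforce
qed

text \<open>Moving the starting point \<open>s\<close> steps along its orbit turns the times
  \<open>j + s\<close> into \<open>j\<close>, so a window may begin anywhere.\<close>

lemma indep_on_translate:
  assumes "indep_on H F A K J" "(\<lambda>j. j + s) ` J' \<subseteq> J" "K \<noteq> {}" "F ` H \<subseteq> H"
  shows "indep_on H F A K J'"
  unfolding indep_on_def
proof (intro allI impI)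
  fix w assume w: "w ` J' \<subseteq> K"
  have "indep_on H F A K ((\<lambda>j. j + s) ` J')"
    using indep_on_subset assms(1-3) by blast
  moreover have "(\<lambda>i. w (i - s)) ` (\<lambda>j. j + s) ` J' \<subseteq> K" using w by auto
  ultimately obtain x where x: "x \<in> H"
    "\<And>i. i \<in> (\<lambda>j. j + s) ` J' \<Longrightarrow> (F ^^ i) x \<in> A (w (i - s))"
    using indep_onD by metis
  have "(F ^^ j) ((F ^^ s) x) \<in> A (w j)" if "j \<in> J'" for j
    using x(2)[of "j + s"] that by (simp add: funpow_add)
  moreover have "(F ^^ s) x \<in> H" using funpow_invariant[OF assms(4) x(1)] .
  ultimately show "\<exists>x\<in>H. \<forall>j\<in>J'. (F ^^ j) x \<in> A (w j)" by blast
qed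

text \<open>Koenig's lemma on the binary tree of prefixes: \<open>ext n S\<close> says that for
  every bound some set good up to it has the prefix \<open>S\<close>. If both continuations failed,
  at \<open>M1\<close> and at \<open>M2\<close>, a set good up to the larger of the two would
  contradict one of the failures.\<close>

lemma exists_set_with_all_prefixes:
  fixes P :: "nat \<Rightarrow> nat set \<Rightarrow> bool"
  assumes ex: "\<And>L. \<exists>I. P L I"
    and loc: "\<And>L I I'. P L I \<Longrightarrow> I \<inter> {1..L} = I' \<inter> {1..L} \<Longrightarrow> P L I'"
    and mono: "\<And>L M I. P M I \<Longrightarrow> L \<le> M \<Longrightarrow> P L I"
  shows "\<exists>I\<subseteq>{1..}. \<forall>L. P L I"
proof -
  define ext where "ext n S \<longleftrightarrow> (\<forall>M. \<exists>I. P M I \<and> I \<inter> {1..n} = S)" for n S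
  have "\<exists>S. \<forall>n. (S n \<subseteq> {1..n} \<and> ext n (S n)) \<and> S (Suc n) \<inter> {1..n} = S n"
  proof (rule dependent_nat_choice)
    show "\<exists>S. S \<subseteq> {1..0} \<and> ext 0 S"
      using ex by (intro exI[of _ "{}"]) (auto simp: ext_def)
  next
    fix S n assume S: "S \<subseteq> {1..n} \<and> ext n S"
    have "ext (Suc n) S \<or> ext (Suc n) (insert (Suc n) S)"
    proof (rule ccontr)
      assume "\<not> ?thesis"
      then obtain M1 M2 where M1: "\<And>I. P M1 I \<Longrightarrow> I \<inter> {1..Suc n} \<noteq> S"
        and M2: "\<And>I. P M2 I \<Longrightarrow> I \<inter> {1..Suc n} \<noteq> insert (Suc n) S"
        unfolding ext_def by blast
      obtain I where I: "P (max M1 M2) I" "I \<inter> {1..n} = S"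
        using S unfolding ext_def by blast
      have "P M1 I" "P M2 I" using I(1) mono by (meson max.cobounded1 max.cobounded2)+
      then have "I \<inter> {1..Suc n} \<noteq> S" "I \<inter> {1..Suc n} \<noteq> insert (Suc n) S"
        using M1 M2 by blast+
      moreover have "I \<inter> {1..Suc n} = (if Suc n \<in> I then insert (Suc n) S else S)"
        using I(2) by (auto simp: atLeastAtMostSuc_conv)
      ultimately show False by (auto split: if_splits)
    qed
    then show "\<exists>S'. (S' \<subseteq> {1..Suc n} \<and> ext (Suc n) S') \<and> S' \<inter> {1..n} = S"
    proof
      assume "ext (Suc n) S"
      then show ?thesis using S by (intro exI[of _ S]) auto
    next
      assume "ext (Suc n) (insert (Suc n) S)"
      then show ?thesis using S by (intro exI[of _ "insert (Suc n) S"]) auto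
    qed
  qed
  then obtain S where S: "\<And>n. S n \<subseteq> {1..n}" "\<And>n. ext n (S n)" "\<And>n. S (Suc n) \<inter> {1..n} = S n"
    by blast
  have pre: "S (n + k) \<inter> {1..n} = S n" for n k
  proof (induction k)
    case 0
    then show ?case using S(1)[of n] by auto
  next
    case (Suc k)
    have "S (n + k) \<inter> {1..n} = S (Suc (n + k)) \<inter> {1..n+k} \<inter> {1..n}"
      by (simp only: S(3))
    also have "\<dots> = S (Suc (n + k)) \<inter> {1..n}" by auto
    finally show ?case using Suc by simp
  qed
  define I where "I = (\<Union>n. S n)"
  have "S m \<inter> {1..n} \<subseteq> S n" for m n
  proof (cases "m \<le> n")
    case True
    then show ?thesis using pre[of m "n - m"] by auto
  next
    case False
    then show ?thesis using pre[of n "m - n"] by simp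
  qed
  then have I: "I \<inter> {1..n} = S n" for n
    using S(1)[of n] unfolding I_def by blast
  have "P n I" for n
  proof -
    obtain I' where "P n I'" "I' \<inter> {1..n} = S n" using S(2)[of n] unfolding ext_def by blast
    then show ?thesis using loc I by simp
  qed
  moreover have "I \<subseteq> {1..}" using S(1) by (fastforce simp: I_def)
  ultimately show ?thesis by blast
qed

text \<open>The window starts where the excess \<open>h\<close> of the counting function over the
  slope \<open>c\<close> is minimal; from there every initial piece has density at least
  \<open>c\<close>. Half of the density is given up to keep the window long: \<open>h\<close> has to
  rise from at most 0 to at least \<open>c * n\<close>, and it grows by at most 1 per step.\<close>

lemma dense_window:
  fixes c :: real and n :: nat
  assumes "J \<subseteq> {1..n}" "2 * c * n \<le> card J" "c > 0"
  shows "\<exists>s\<le>n. c * n \<le> real (n - s) \<and> (\<forall>l\<le>n-s. c * l \<le> card (J \<inter> {s<..s+l}))"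
proof -
  define h where "h s = real (card (J \<inter> {1..s})) - c * s" for s :: nat
  have add: "card (J \<inter> {1..s+l}) = card (J \<inter> {1..s}) + card (J \<inter> {s<..s+l})" for s l
  proof -
    have "J \<inter> {1..s+l} = (J \<inter> {1..s}) \<union> (J \<inter> {s<..s+l})"
      using assms(1) by auto
    then show ?thesis by (simp add: card_Un_disjoint disjoint_iff)
  qed
  have "Min (h ` {0..n}) \<in> h ` {0..n}" by (intro Min_in) auto
  then obtain s where s: "s \<le> n" "h s = Min (h ` {0..n})"
    by (metis atLeastAtMost_iff imageE)
  have min: "h s \<le> h s'" if "s' \<le> n" for s'
    using that by (simp add: s(2))
  have "J \<inter> {1..n} = J" using assms(1) by auto
  then have "c * n \<le> h n" using assms(2) by (simp add: h_def)
  moreover have "h s \<le> 0" using min[of 0] by (simp add: h_def)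
  moreover have "h n - h s \<le> real (n - s)"
  proof -
    have "card (J \<inter> {1..n}) = card (J \<inter> {1..s}) + card (J \<inter> {s<..n})"
      using add[of s "n - s"] s(1) by simp
    moreover have "card (J \<inter> {s<..n}) \<le> n - s"
      using card_mono[of "{s<..n}" "J \<inter> {s<..n}"] by simp
    moreover have "c * s \<le> c * n" using s(1) assms(3) by simp
    ultimately show ?thesis using s(1) by (simp add: h_def of_nat_diff)
  qed
  ultimately have "c * n \<le> real (n - s)" by linarith
  moreover have "c * l \<le> card (J \<inter> {s<..s+l})" if "l \<le> n - s" for l
    using min[of "s + l"] that s(1) add[of s l] by (simp add: h_def distrib_left)
  ultimately show ?thesis using s(1) by blast
qed

lemma dense_indep_infinite:
  assumes "dense_indep H F A K" "K \<noteq> {}" "F ` H \<subseteq> H"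
  obtains c I where "c > 0" "I \<subseteq> {1..}" "\<And>L. c * real L \<le> real (card (I \<inter> {1..L}))"
    "\<And>J. finite J \<Longrightarrow> J \<subseteq> I \<Longrightarrow> indep_on H F A K J"
proof -
  obtain c0 where c0: "c0 > 0" and f: "\<exists>\<^sub>F n in sequentially.
     \<exists>J\<subseteq>{1..n}. c0 * real n \<le> real (card J) \<and> indep_on H F A K J"
    using assms(1) unfolding dense_indep_def by blast
  define c where "c = c0 / 2"
  have c: "c > 0" "c0 = 2 * c" using c0 by (simp_all add: c_def)
  \<comment> \<open>The density of every prefix up to \<open>L\<close> is demanded, so that the
    limit set has positive lower density and not only dense windows.\<close>
  define P where "P L I \<longleftrightarrow> (\<forall>l\<le>L. c * real l \<le> real (card (I \<inter> {1..l}))) \<and>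
      indep_on H F A K (I \<inter> {1..L})" for L I
  have "\<exists>I\<subseteq>{1..}. \<forall>L. P L I"
  proof (rule exists_set_with_all_prefixes)
    fix L :: nat
    \<comment> \<open>With this \<open>n\<close> the window that remains after cutting has length at
      least \<open>c * n\<close>, hence at least \<open>L\<close>.\<close>
    obtain n J where n: "n \<ge> nat \<lceil>real L / c\<rceil>" and J: "J \<subseteq> {1..n}" "c0 * real n \<le> real (card J)"
      "indep_on H F A K J"
      using f unfolding frequently_sequentially by blast
    have "2 * c * real n \<le> real (card J)" using J(2) c(2) by simp
    then obtain s where s: "s \<le> n" "c * n \<le> real (n - s)"
      "\<And>l. l \<le> n - s \<Longrightarrow> c * l \<le> card (J \<inter> {s<..s+l})"
      using dense_window[OF J(1) _ c(1)] by blast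
    have "real L / c \<le> n" using n by linarith
    then have "real L \<le> c * n" using c by (simp add: field_simps)
    then have L: "L \<le> n - s" using s(2) by linarith
    define I where "I = {j. j + s \<in> J}"
    have "P L I"
      unfolding P_def
    proof (intro conjI allI impI)
      fix l assume "l \<le> L"
      have "bij_betw (\<lambda>j. j + s) (I \<inter> {1..l}) (J \<inter> {s<..s+l})"
        by (rule bij_betwI[of _ _ _ "\<lambda>j. j - s"]) (auto simp: I_def)
      then have "card (I \<inter> {1..l}) = card (J \<inter> {s<..s+l})"
        by (rule bij_betw_same_card)
      then show "c * real l \<le> real (card (I \<inter> {1..l}))"
        using s(3)[of l] \<open>l \<le> L\<close> L by simp
    next
      show "indep_on H F A K (I \<inter> {1..L})"
        by (rule indep_on_translate[OF J(3) _ assms(2,3), of s]) (auto simp: I_def)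
    qed
    then show "\<exists>I. P L I" by blast
  next
    fix L I I' assume P: "P L I" and eq: "I \<inter> {1..L} = I' \<inter> {1..L}"
    have "I \<inter> {1..l} = I' \<inter> {1..l}" if "l \<le> L" for l
    proof -
      have "I \<inter> {1..l} = (I \<inter> {1..L}) \<inter> {1..l}" "I' \<inter> {1..l} = (I' \<inter> {1..L}) \<inter> {1..l}"
        using that by auto
      then show ?thesis using eq by simp
    qed
    then show "P L I'" using P eq by (simp add: P_def)
  next
    fix L M I assume P: "P M I" and le: "L \<le> (M::nat)"
    have "indep_on H F A K (I \<inter> {1..L})"
      by (rule indep_on_subset[of _ _ _ _ "I \<inter> {1..M}"]) (use P le assms(2) in \<open>auto simp: P_def\<close>)
    then show "P L I" using P le by (simp add: P_def)
  qed
  then obtain I where I: "I \<subseteq> {1..}" "\<And>L. P L I" by blast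
  show thesis
  proof (rule that[OF c(1) I(1)])
    show "c * real L \<le> real (card (I \<inter> {1..L}))" for L
      using I(2)[of L] by (simp add: P_def)
    show "indep_on H F A K J" if J: "finite J" "J \<subseteq> I" for J
    proof (rule indep_on_subset[OF _ _ assms(2)])
      show "indep_on H F A K (I \<inter> {1..Max (insert 0 J)})"
        using I(2) by (simp add: P_def)
      show "J \<subseteq> I \<inter> {1..Max (insert 0 J)}"
        using J I(1) by (auto intro!: Max_ge)
    qed
  qed
qed

subsection \<open>Cantor schemes\<close>

text \<open>The letters of \<open>K'\<close> are children and \<open>h\<close> assigns their
  parents. Since the shift lemma moves a family into itself, a map \<open>\<phi>\<close> to parents
  is lifted to a map \<open>\<psi>\<close> to children with
  \<open>h \<circ> \<psi> = \<phi>\<close>. The maps can be treated one by one, because shrinking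
  the sets keeps the inclusions already gained.\<close>

lemma dense_indep_itineraries:
  fixes H :: "'b::metric_space set" and K' :: "'j set" and h :: "'j \<Rightarrow> 'i"
  assumes "continuous_on H F" "F ` H \<subseteq> H" "dense_indep H F A K"
    and "h ` K' = K" "K' \<noteq> {}"
    and A: "\<And>i. i \<in> K \<Longrightarrow> closed (A i) \<and> A i \<subseteq> H"
    and "finite \<Phi>" "\<And>\<phi>. \<phi> \<in> \<Phi> \<Longrightarrow> \<phi> ` K' \<subseteq> K"
  shows "\<exists>B. dense_indep H F B K' \<and> (\<forall>i\<in>K'. closed (B i) \<and> B i \<subseteq> A (h i)) \<and>
           (\<forall>\<phi>\<in>\<Phi>. \<exists>n\<ge>b. \<forall>i\<in>K'. (F ^^ n) ` B i \<subseteq> A (\<phi> i))"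
  using assms(7,8)
proof (induction \<Phi> rule: finite_induct)
  case empty
  have "dense_indep H F (\<lambda>i. A (h i)) K'"
    by (rule dense_indep_reindex[OF assms(3)]) (use assms(4) in auto)
  then show ?case using A assms(4) by (intro exI[of _ "\<lambda>i. A (h i)"]) auto
next
  case (insert \<phi> \<Phi>)
  then obtain B where B: "dense_indep H F B K'" "\<forall>i\<in>K'. closed (B i) \<and> B i \<subseteq> A (h i)"
    "\<forall>\<phi>\<in>\<Phi>. \<exists>n\<ge>b. \<forall>i\<in>K'. (F ^^ n) ` B i \<subseteq> A (\<phi> i)" by auto
  define \<psi> where "\<psi> i = inv_into K' h (\<phi> i)" for i
  have \<phi>: "\<phi> i \<in> h ` K'" if "i \<in> K'" for i
    using insert.prems that assms(4) by auto
  have \<psi>: "\<psi> i \<in> K'" "h (\<psi> i) = \<phi> i" if "i \<in> K'" for i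
    unfolding \<psi>_def by (rule inv_into_into[OF \<phi>[OF that]], rule f_inv_into_f[OF \<phi>[OF that]])
  have "\<psi> ` K' \<subseteq> K'" using \<psi>(1) by auto
  from dense_indep_shift[OF B(1) this assms(5), of b]
  obtain n where n: "n \<ge> b" "dense_indep H F (\<lambda>i. {x \<in> B i. (F ^^ n) x \<in> B (\<psi> i)}) K'" by blast
  define B' where "B' i = {x \<in> B i. (F ^^ n) x \<in> B (\<psi> i)}" for i
  have "closed (B' i)" if "i \<in> K'" for i
  proof -
    have "B i \<subseteq> H" using B(2) A that assms(4) by blast
    then have "continuous_on (B i) (F ^^ n)"
      using continuous_on_funpow[OF assms(2,1)] continuous_on_subset by blast
    then have "closed (B i \<inter> (F ^^ n) -` B (\<psi> i))"
      using B(2) \<psi>(1) that by (intro continuous_closed_preimage) auto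
    moreover have "B' i = B i \<inter> (F ^^ n) -` B (\<psi> i)" by (auto simp: B'_def)
    ultimately show ?thesis by simp
  qed
  moreover have B'B: "B' i \<subseteq> B i" for i by (auto simp: B'_def)
  moreover have "\<forall>i\<in>K'. (F ^^ n) ` B' i \<subseteq> A (\<phi> i)"
  proof
    fix i assume i: "i \<in> K'"
    have "B (\<psi> i) \<subseteq> A (\<phi> i)" using B(2) \<psi>[OF i] by metis
    then show "(F ^^ n) ` B' i \<subseteq> A (\<phi> i)" by (auto simp: B'_def)
  qed
  moreover have "\<forall>\<phi>\<in>\<Phi>. \<exists>n\<ge>b. \<forall>i\<in>K'. (F ^^ n) ` B' i \<subseteq> A (\<phi> i)"
    using B(3) B'B by (meson image_mono subset_trans)
  ultimately have "\<forall>i\<in>K'. closed (B' i) \<and> B' i \<subseteq> A (h i)"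
    "\<forall>\<phi>\<in>insert \<phi> \<Phi>. \<exists>n\<ge>b. \<forall>i\<in>K'. (F ^^ n) ` B' i \<subseteq> A (\<phi> i)"
    using B(2) n(1) by (blast, blast)
  then show ?case using n(2) unfolding B'_def[symmetric] by blast
qed

text \<open>The children of one parent start as equal copies. Two of them are told apart by an
  itinerary sending \<open>i\<close> to \<open>a\<close> and every other child to \<open>b\<close>:
  one iterate maps \<open>B i\<close> and \<open>B j\<close> into disjoint sets. Only the values of
  \<open>\<phi>\<close> on \<open>K'\<close> matter, which leaves finitely many maps to
  realize.\<close>

lemma dense_indep_mixing_refinement:
  fixes H :: "'b::metric_space set" and K' :: "'j set" and h :: "'j \<Rightarrow> 'i"
  assumes "compact H" "continuous_on H F" "F ` H \<subseteq> H" "dense_indep H F A K"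
    and "h ` K' = K" "finite K'"
    and A: "\<And>i. i \<in> K \<Longrightarrow> closed (A i) \<and> A i \<subseteq> H"
    and ab: "a \<in> K" "b \<in> K" "A a \<inter> A b = {}" and "\<epsilon> > 0"
  shows "\<exists>B. dense_indep H F B K' \<and> (\<forall>i\<in>K'. closed (B i) \<and> B i \<subseteq> A (h i) \<and>
             (\<forall>x\<in>B i. \<forall>y\<in>B i. dist x y \<le> \<epsilon>)) \<and>
           (\<forall>i\<in>K'. \<forall>j\<in>K'. i \<noteq> j \<longrightarrow> B i \<inter> B j = {}) \<and>
           (\<forall>\<phi>. \<phi> ` K' \<subseteq> K \<longrightarrow> (\<exists>n\<ge>N. \<forall>i\<in>K'. (F ^^ n) ` B i \<subseteq> A (\<phi> i)))"
proof -
  have K': "K' \<noteq> {}" using ab assms(5) by auto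
  have "finite K" using assms(5,6) by auto
  have "\<exists>B. dense_indep H F B K' \<and> (\<forall>i\<in>K'. closed (B i) \<and> B i \<subseteq> A (h i)) \<and>
           (\<forall>\<phi>\<in>K' \<rightarrow>\<^sub>E K. \<exists>n\<ge>N. \<forall>i\<in>K'. (F ^^ n) ` B i \<subseteq> A (\<phi> i))"
    by (rule dense_indep_itineraries[OF assms(2-5) K' A])
       (use assms(6) \<open>finite K\<close> in \<open>auto intro: finite_PiE\<close>)
  then obtain B0 where B0: "dense_indep H F B0 K'" "\<forall>i\<in>K'. closed (B0 i) \<and> B0 i \<subseteq> A (h i)"
    "\<forall>\<phi>\<in>K' \<rightarrow>\<^sub>E K. \<exists>n\<ge>N. \<forall>i\<in>K'. (F ^^ n) ` B0 i \<subseteq> A (\<phi> i)"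
    by (elim exE conjE) (rule that)
  have "B0 i \<subseteq> H \<and> closed (B0 i)" if "i \<in> K'" for i
  proof -
    have "h i \<in> K" using assms(5) that by auto
    then have "A (h i) \<subseteq> H" using A by simp
    then show ?thesis using B0(2) that by fastforce
  qed
  from dense_indep_small[OF B0(1) assms(6,1) \<open>\<epsilon> > 0\<close> this]
  obtain B where B: "dense_indep H F B K'" "\<forall>i\<in>K'. B i \<subseteq> B0 i \<and> closed (B i) \<and>
           (\<forall>x\<in>B i. \<forall>y\<in>B i. dist x y \<le> \<epsilon>)" by blast
  have \<phi>: "\<exists>n\<ge>N. \<forall>i\<in>K'. (F ^^ n) ` B i \<subseteq> A (\<phi> i)" if "\<phi> ` K' \<subseteq> K" for \<phi>
  proof -
    have "restrict \<phi> K' \<in> K' \<rightarrow>\<^sub>E K" using that by auto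
    then obtain n where n: "n \<ge> N" "\<forall>i\<in>K'. (F ^^ n) ` B0 i \<subseteq> A (restrict \<phi> K' i)"
      using B0(3) by blast
    have "(F ^^ n) ` B i \<subseteq> A (\<phi> i)" if "i \<in> K'" for i
    proof -
      have "(F ^^ n) ` B i \<subseteq> (F ^^ n) ` B0 i" using B(2) that by blast
      also have "\<dots> \<subseteq> A (\<phi> i)" using n(2) that by (metis restrict_apply')
      finally show ?thesis .
    qed
    then show ?thesis using n(1) by blast
  qed
  have "B i \<inter> B j = {}" if "i \<in> K'" "j \<in> K'" "i \<noteq> j" for i j
  proof -
    have "(\<lambda>l. if l = i then a else b) ` K' \<subseteq> K" using ab by auto
    from \<phi>[OF this] obtain n where
      n: "\<forall>l\<in>K'. (F ^^ n) ` B l \<subseteq> A (if l = i then a else b)" by blast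
    have "(F ^^ n) ` B i \<subseteq> A a" "(F ^^ n) ` B j \<subseteq> A b"
      using bspec[OF n that(1)] bspec[OF n that(2)] that(3) by auto
    then show ?thesis using ab(3) by blast
  qed
  moreover have "\<forall>i\<in>K'. closed (B i) \<and> B i \<subseteq> A (h i) \<and> (\<forall>x\<in>B i. \<forall>y\<in>B i. dist x y \<le> \<epsilon>)"
    using B(2) B0(2) by blast
  ultimately show ?thesis using B(1) \<phi> by blast
qed

section \<open>Branches through a scheme of closed sets\<close>

lemma compact_Cantor_space: "compact (UNIV :: (nat \<Rightarrow> bool) set)"
proof -
  have "compact (UNIV :: bool set)" by (simp add: finite_imp_compact)
  then have "compact_space (euclidean :: bool topology)"
    by (simp add: compact_space_def)
  then have "compact_space (product_topology (\<lambda>i::nat. euclidean :: bool topology) UNIV)"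
    by (simp add: compact_space_product_topology)
  then show ?thesis
    by (simp add: euclidean_product_topology compact_space_def)
qed

text \<open>Compactness puts a point on every branch, disjointness makes the choice injective, small
  diameters make it continuous, and a continuous injection of a compact space is a homeomorphism
  onto its image. Level \<open>m\<close> is indexed by words of length \<open>Suc m\<close>, so that
  a pair of sets forms level 0; no diameter is prescribed there.\<close>

lemma Cantor_scheme:
  fixes \<A> :: "nat \<Rightarrow> bool list \<Rightarrow> 'b::metric_space set"
  defines "pre \<equiv> \<lambda>m (s::nat \<Rightarrow> bool). map s [0..<Suc m]"
  assumes "compact H"
    and cl: "\<And>m l. length l = Suc m \<Longrightarrow> closed (\<A> m l) \<and> \<A> m l \<subseteq> H \<and> \<A> m l \<noteq> {}"
    and disj: "\<And>m l l'. length l = Suc m \<Longrightarrow> length l' = Suc m \<Longrightarrow> l \<noteq> l' \<Longrightarrow> \<A> m l \<inter> \<A> m l' = {}"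
    and nest: "\<And>m l. length l = Suc (Suc m) \<Longrightarrow> \<A> (Suc m) l \<subseteq> \<A> m (butlast l)"
    and small: "\<And>m l x y. length l = Suc (Suc m) \<Longrightarrow> x \<in> \<A> (Suc m) l \<Longrightarrow> y \<in> \<A> (Suc m) l \<Longrightarrow>
                  dist x y \<le> 1 / Suc m"
  obtains z :: "(nat \<Rightarrow> bool) \<Rightarrow> 'b" where "inj z" "range z \<subseteq> H" "Cantor_set (range z)"
    "\<And>m s. z s \<in> \<A> m (pre m s)"
proof -
  have len: "length (pre m s) = Suc m" for m s by (simp add: pre_def)
  have but: "butlast (pre (Suc m) s) = pre m s" for m s
    by (simp add: pre_def butlast_append)
  have dec: "\<A> (m + k) (pre (m + k) s) \<subseteq> \<A> m (pre m s)" for m k s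
  proof (induction k)
    case (Suc k)
    have "\<A> (Suc (m + k)) (pre (Suc (m + k)) s) \<subseteq> \<A> (m + k) (pre (m + k) s)"
      using nest[OF len, of "m + k" s] but by metis
    then show ?case using Suc by auto
  qed simp
  have "\<exists>x. \<forall>m. x \<in> \<A> m (pre m s)" for s
  proof -
    have "H \<inter> (\<Inter>m\<in>UNIV. \<A> m (pre m s)) \<noteq> {}"
    proof (rule compact_imp_fip_image[OF assms(2)])
      show "closed (\<A> m (pre m s))" for m using cl[OF len] by blast
      fix M :: "nat set" assume "finite M"
      define n where "n = Max (insert 0 M)"
      obtain x where x: "x \<in> \<A> n (pre n s)" using cl[OF len] by blast
      then have "x \<in> H" using cl[OF len] by blast
      moreover have "x \<in> \<A> m (pre m s)" if "m \<in> M" for m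
      proof -
        have "m \<le> n" using \<open>finite M\<close> that by (simp add: n_def)
        then show ?thesis using dec[of m "n - m" s] x by auto
      qed
      ultimately show "H \<inter> (\<Inter>m\<in>M. \<A> m (pre m s)) \<noteq> {}" by blast
    qed
    then show ?thesis by blast
  qed
  then obtain z where z: "\<And>m s. z s \<in> \<A> m (pre m s)" by metis
  have "inj z"
  proof (rule injI, rule ccontr)
    fix s t assume eq: "z s = z t" and "s \<noteq> t"
    then obtain i where "s i \<noteq> t i" by blast
    then have "pre i s \<noteq> pre i t" by (simp add: pre_def)
    from disj[OF len len this] show False using z[of s i] z[of t i] eq by auto
  qed
  have H: "range z \<subseteq> H" using z[of _ 0] cl[OF len] by blast
  have "continuous_on UNIV z"
    unfolding continuous_on_def
  proof (intro ballI tendstoI)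
    fix s :: "nat \<Rightarrow> bool" and \<epsilon> :: real assume "\<epsilon> > 0"
    then obtain m where m: "1 / Suc m < \<epsilon>" using nat_approx_posE by metis
    have "open {t :: nat \<Rightarrow> bool. \<forall>i\<in>{..Suc m}. t i \<in> {s i}}"
      by (rule product_topology_basis') (auto simp: open_discrete)
    moreover have "dist (z t) (z s) < \<epsilon>" if "t \<in> {t. \<forall>i\<in>{..Suc m}. t i \<in> {s i}}" for t
    proof -
      have "pre (Suc m) t = pre (Suc m) s" using that by (auto simp: pre_def)
      then have "dist (z t) (z s) \<le> 1 / Suc m"
        using small[OF len[of "Suc m" s]] z[of t "Suc m"] z[of s "Suc m"] by simp
      then show ?thesis using m by simp
    qed
    moreover have "s \<in> {t. \<forall>i\<in>{..Suc m}. t i \<in> {s i}}" by simp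
    ultimately show "\<forall>\<^sub>F t in at s within UNIV. dist (z t) (z s) < \<epsilon>"
      unfolding eventually_at_topological by blast
  qed
  then have "(UNIV :: (nat \<Rightarrow> bool) set) homeomorphic range z"
    using homeomorphic_compact[OF compact_Cantor_space _ refl \<open>inj z\<close>] by blast
  then have "Cantor_set (range z)"
    unfolding Cantor_set_def by (rule homeomorphic_sym[THEN iffD1])
  then show thesis using that \<open>inj z\<close> H z by blast
qed

text \<open>A finite set of points of \<open>Z\<close> is resolved by a deep enough level, where its
  points lie in distinct cells. Prescribing targets in \<open>Z\<close> then amounts to one of the
  maps from this level to the previous one.\<close>

theorem Cantor_set_of_dense_indep_pair:
  fixes H P Q :: "'b::metric_space set"
  assumes H: "compact H" "continuous_on H F" "F ` H \<subseteq> H"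
    and PQ: "closed P" "closed Q" "P \<subseteq> H" "Q \<subseteq> H" "P \<inter> Q = {}"
    and dens: "dense_indep H F (\<lambda>b. if b then P else Q) UNIV"
  shows "\<exists>Z\<subseteq>H. Cantor_set Z \<and>
    (\<forall>xs As. set xs \<subseteq> Z \<longrightarrow> (\<forall>i<length xs. \<exists>e>0. H \<inter> ball (xs ! i) e \<subseteq> As i) \<longrightarrow>
       dense_indep H F As {..<length xs}) \<and>
    (\<forall>S \<phi> \<epsilon> N. finite S \<longrightarrow> S \<subseteq> Z \<longrightarrow> \<phi> ` S \<subseteq> Z \<longrightarrow> 0 < \<epsilon> \<longrightarrow>
       (\<exists>n\<ge>N. \<forall>y\<in>S. dist ((F ^^ n) y) (\<phi> y) < \<epsilon>))"
proof -
  define Kl where "Kl m = {l :: bool list. length l = Suc m}" for m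
  have finKl: "finite (Kl m)" for m
    unfolding Kl_def using finite_lists_length_eq[of "UNIV :: bool set" "Suc m"] by simp
  have butl: "butlast ` Kl (Suc m) = Kl m" for m
  proof -
    have "l \<in> butlast ` Kl (Suc m)" if "l \<in> Kl m" for l
      by (rule image_eqI[of _ _ "l @ [True]"]) (use that in \<open>auto simp: Kl_def\<close>)
    then show ?thesis by (auto simp: Kl_def)
  qed
  define good where "good m A \<longleftrightarrow> dense_indep H F A (Kl m) \<and>
      (\<forall>l\<in>Kl m. closed (A l) \<and> A l \<subseteq> H) \<and>
      (\<forall>l\<in>Kl m. \<forall>l'\<in>Kl m. l \<noteq> l' \<longrightarrow> A l \<inter> A l' = {})" for m and A :: "bool list \<Rightarrow> 'b set"
  \<comment> \<open>The level also bounds the iterate from below, so that deep levels give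
    arbitrarily late times.\<close>
  define nxt where "nxt m A B \<longleftrightarrow>
      (\<forall>l\<in>Kl (Suc m). B l \<subseteq> A (butlast l) \<and> (\<forall>x\<in>B l. \<forall>y\<in>B l. dist x y \<le> 1 / Suc m)) \<and>
      (\<forall>\<phi>. \<phi> ` Kl (Suc m) \<subseteq> Kl m \<longrightarrow> (\<exists>n\<ge>m. \<forall>l\<in>Kl (Suc m). (F ^^ n) ` B l \<subseteq> A (\<phi> l)))"
    for m and A B :: "bool list \<Rightarrow> 'b set"
  have "\<exists>\<A>. \<forall>m. good m (\<A> m) \<and> nxt m (\<A> m) (\<A> (Suc m))"
  proof (rule dependent_nat_choice)
    have "dense_indep H F (\<lambda>l. if hd l then P else Q) (Kl 0)"
      by (rule dense_indep_reindex[OF dens, of hd]) auto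
    moreover have "hd l \<noteq> hd l'" if "l \<in> Kl 0" "l' \<in> Kl 0" "l \<noteq> l'" for l l'
      using that by (auto simp: Kl_def length_Suc_conv)
    then have "\<forall>l\<in>Kl 0. \<forall>l'\<in>Kl 0. l \<noteq> l' \<longrightarrow> (if hd l then P else Q) \<inter> (if hd l' then P else Q) = {}"
      using PQ(5) by (metis Int_commute)
    ultimately have "good 0 (\<lambda>l. if hd l then P else Q)"
      using PQ unfolding good_def by simp
    then show "\<exists>A. good 0 A" by blast
  next
    fix A m assume "good m A"
    then have A: "dense_indep H F A (Kl m)" "\<And>l. l \<in> Kl m \<Longrightarrow> closed (A l) \<and> A l \<subseteq> H"
      "\<And>l l'. l \<in> Kl m \<Longrightarrow> l' \<in> Kl m \<Longrightarrow> l \<noteq> l' \<Longrightarrow> A l \<inter> A l' = {}"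
      unfolding good_def by auto
    \<comment> \<open>Two words with disjoint sets, by which the children at the next level are
      separated.\<close>
    have ab: "replicate (Suc m) True \<in> Kl m" "replicate (Suc m) False \<in> Kl m"
      "replicate (Suc m) True \<noteq> replicate (Suc m) False"
      by (auto simp: Kl_def)
    obtain B where B: "dense_indep H F B (Kl (Suc m))"
      "\<forall>i\<in>Kl (Suc m). closed (B i) \<and> B i \<subseteq> A (butlast i) \<and>
             (\<forall>x\<in>B i. \<forall>y\<in>B i. dist x y \<le> 1 / Suc m)"
      "\<forall>i\<in>Kl (Suc m). \<forall>j\<in>Kl (Suc m). i \<noteq> j \<longrightarrow> B i \<inter> B j = {}"
      "\<forall>\<phi>. \<phi> ` Kl (Suc m) \<subseteq> Kl m \<longrightarrow> (\<exists>n\<ge>m. \<forall>i\<in>Kl (Suc m). (F ^^ n) ` B i \<subseteq> A (\<phi> i))"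
      using dense_indep_mixing_refinement[OF H A(1) butl finKl A(2) ab(1,2) A(3)[OF ab],
          of "1 / Suc m" m] by auto
    have "B i \<subseteq> H" if "i \<in> Kl (Suc m)" for i
      using B(2) A(2) that butl[of m] by blast
    then have "good (Suc m) B" using B unfolding good_def by blast
    moreover have "nxt m A B" using B unfolding nxt_def by blast
    ultimately show "\<exists>B. good (Suc m) B \<and> nxt m A B" by blast
  qed
  then obtain \<A> where good: "\<And>m. good m (\<A> m)" and nxt: "\<And>m. nxt m (\<A> m) (\<A> (Suc m))"
    by blast
  define pre where "pre m (s::nat \<Rightarrow> bool) = map s [0..<Suc m]" for m s
  have pre: "pre m s \<in> Kl m" for m s by (simp add: pre_def Kl_def)
  obtain z :: "(nat \<Rightarrow> bool) \<Rightarrow> 'b" where z: "inj z" "range z \<subseteq> H" "Cantor_set (range z)"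
    "\<And>m s. z s \<in> \<A> m (pre m s)"
  proof (rule Cantor_scheme[OF H(1), of \<A>])
    show "closed (\<A> m l) \<and> \<A> m l \<subseteq> H \<and> \<A> m l \<noteq> {}" if "length l = Suc m" for m l
      using good[of m] dense_indep_nonempty[of H F "\<A> m" "Kl m" l] that
      by (simp add: good_def Kl_def)
    show "\<A> m l \<inter> \<A> m l' = {}" if "length l = Suc m" "length l' = Suc m" "l \<noteq> l'" for m l l'
      using good[of m] that unfolding good_def Kl_def by blast
    show "\<A> (Suc m) l \<subseteq> \<A> m (butlast l)" if "length l = Suc (Suc m)" for m l
      using nxt[of m] that unfolding nxt_def Kl_def by blast
    show "dist x y \<le> 1 / Suc m" if "length l = Suc (Suc m)" "x \<in> \<A> (Suc m) l" "y \<in> \<A> (Suc m) l"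
      for m l x y
      using nxt[of m] that unfolding nxt_def Kl_def by blast
  qed (use that in \<open>auto simp: pre_def\<close>)
  define \<sigma> where "\<sigma> = inv z"
  have \<sigma>: "z (\<sigma> y) = y" if "y \<in> range z" for y
    using that by (simp add: \<sigma>_def f_inv_into_f)
  have mem: "y \<in> \<A> m (pre m (\<sigma> y))" if "y \<in> range z" for y m
    using z(4)[of "\<sigma> y" m] \<sigma>[OF that] by simp
  have close: "dist x y \<le> 1 / Suc m" if "x \<in> \<A> (Suc m) (pre (Suc m) s)" "y \<in> \<A> (Suc m) (pre (Suc m) s)"
    for x y m s
    using nxt[of m] that pre[of "Suc m" s] unfolding nxt_def by blast
  have inv_le: "\<forall>\<^sub>F m in sequentially. 1 / real (Suc m) < e" if "e > 0" for e
    using LIMSEQ_inverse_real_of_nat that order_tendstoD(2)[of "\<lambda>n. inverse (real (Suc n))" 0 sequentially e]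
    by (simp add: inverse_eq_divide)
  show ?thesis
  proof (intro exI[of _ "range z"] conjI allI impI)
    show "range z \<subseteq> H" "Cantor_set (range z)" by (rule z)+
    fix xs :: "'b list" and As assume xs: "set xs \<subseteq> range z"
      and As: "\<forall>i<length xs. \<exists>e>0. H \<inter> ball (xs ! i) e \<subseteq> As i"
    have "\<forall>\<^sub>F m in sequentially. \<forall>i\<in>{..<length xs}. \<A> (Suc m) (pre (Suc m) (\<sigma> (xs ! i))) \<subseteq> As i"
    proof (rule eventually_ball_finite[OF finite_lessThan], rule ballI)
      fix i assume i: "i \<in> {..<length xs}"
      then obtain e where e: "e > 0" "H \<inter> ball (xs ! i) e \<subseteq> As i" using As by blast
      have xi: "xs ! i \<in> range z" using xs i by auto
      show "\<forall>\<^sub>F m in sequentially. \<A> (Suc m) (pre (Suc m) (\<sigma> (xs ! i))) \<subseteq> As i"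
        using inv_le[OF e(1)]
      proof (rule eventually_mono)
        fix m assume m: "1 / real (Suc m) < e"
        have "\<A> (Suc m) (pre (Suc m) (\<sigma> (xs ! i))) \<subseteq> H"
          using good[of "Suc m"] pre unfolding good_def by blast
        moreover have "dist (xs ! i) x < e" if "x \<in> \<A> (Suc m) (pre (Suc m) (\<sigma> (xs ! i)))" for x
          using close[OF mem[OF xi] that] m by simp
        ultimately show "\<A> (Suc m) (pre (Suc m) (\<sigma> (xs ! i))) \<subseteq> As i"
          using e(2) by auto
      qed
    qed
    then obtain m where m: "\<And>i. i < length xs \<Longrightarrow> \<A> (Suc m) (pre (Suc m) (\<sigma> (xs ! i))) \<subseteq> As i"
      using eventually_happens'[OF sequentially_bot] by blast
    have "dense_indep H F (\<A> (Suc m)) (Kl (Suc m))"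
      using good[of "Suc m"] by (simp add: good_def)
    \<comment> \<open>Each position of the tuple is read as the cell of its point; positions holding
      equal points share a cell.\<close>
    then show "dense_indep H F As {..<length xs}"
      by (rule dense_indep_reindex[of _ _ _ _ "\<lambda>i. pre (Suc m) (\<sigma> (xs ! i))"])
         (use pre m in auto)
  next
    fix S \<phi> \<epsilon> and N :: nat
    assume S: "finite S" "S \<subseteq> range z" "\<phi> ` S \<subseteq> range z" and "(\<epsilon>::real) > 0"
    have "\<forall>\<^sub>F m in sequentially. pre m s \<noteq> pre m t" if "s \<noteq> t" for s t
    proof -
      obtain i where i: "s i \<noteq> t i" using \<open>s \<noteq> t\<close> by blast
      show ?thesis
      proof (rule eventually_sequentiallyI)
        fix m assume "i \<le> m"
        then have "pre m s ! i = s i" "pre m t ! i = t i"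
          by (simp_all add: pre_def del: upt_Suc)
        then show "pre m s \<noteq> pre m t" using i by metis
      qed
    qed
    moreover have "\<sigma> x \<noteq> \<sigma> y" if "x \<in> S" "y \<in> S" "x \<noteq> y" for x y
      using that \<sigma> S(2) by (metis subsetD)
    ultimately have "\<forall>\<^sub>F m in sequentially. x \<noteq> y \<longrightarrow> pre m (\<sigma> x) \<noteq> pre m (\<sigma> y)"
      if "x \<in> S" "y \<in> S" for x y
      using that by (cases "x = y") auto
    then have "\<forall>\<^sub>F m in sequentially. \<forall>x\<in>S. \<forall>y\<in>S. x \<noteq> y \<longrightarrow> pre m (\<sigma> x) \<noteq> pre m (\<sigma> y)"
      using S(1) by (intro eventually_ball_finite ballI) auto
    moreover have "\<forall>\<^sub>F m in sequentially. m \<ge> N" by (rule eventually_ge_at_top)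
    moreover note inv_le[OF \<open>\<epsilon> > 0\<close>]
    ultimately have "\<forall>\<^sub>F m in sequentially. (\<forall>x\<in>S. \<forall>y\<in>S. x \<noteq> y \<longrightarrow> pre m (\<sigma> x) \<noteq> pre m (\<sigma> y)) \<and>
        N \<le> m \<and> 1 / real (Suc m) < \<epsilon>"
      by (intro eventually_conj)
    then obtain M where M: "\<And>m. m \<ge> M \<Longrightarrow> (\<forall>x\<in>S. \<forall>y\<in>S. x \<noteq> y \<longrightarrow> pre m (\<sigma> x) \<noteq> pre m (\<sigma> y)) \<and>
        N \<le> m \<and> 1 / real (Suc m) < \<epsilon>"
      unfolding eventually_sequentially by blast
    \<comment> \<open>The image of a point and its target meet in a cell of level \<open>m\<close>;
      the successor makes the diameter bound of that level equal to
      \<open>1 / Suc M\<close>.\<close>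
    define m where "m = Suc M"
    have inj: "inj_on (\<lambda>x. pre (Suc m) (\<sigma> x)) S"
      using M[of "Suc m"] by (auto simp: m_def inj_on_def)
    \<comment> \<open>On the cells of points of \<open>S\<close> this names the cell of the target,
      which is well defined because these cells are distinct; all other cells get an arbitrary word
      of level \<open>m\<close>.\<close>
    define \<psi> where "\<psi> l = (if l \<in> (\<lambda>x. pre (Suc m) (\<sigma> x)) ` S
        then pre m (\<sigma> (\<phi> (inv_into S (\<lambda>x. pre (Suc m) (\<sigma> x)) l))) else pre m (\<lambda>_. True))" for l
    have "\<psi> ` Kl (Suc m) \<subseteq> Kl m" using pre by (auto simp: \<psi>_def)
    then obtain n where n: "n \<ge> m" "\<forall>l\<in>Kl (Suc m). (F ^^ n) ` \<A> (Suc m) l \<subseteq> \<A> m (\<psi> l)"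
      using nxt[of m] unfolding nxt_def by blast
    have "dist ((F ^^ n) y) (\<phi> y) < \<epsilon>" if y: "y \<in> S" for y
    proof -
      have "\<psi> (pre (Suc m) (\<sigma> y)) = pre m (\<sigma> (\<phi> y))"
        using inv_into_f_f[OF inj y] y by (simp add: \<psi>_def)
      moreover have "y \<in> \<A> (Suc m) (pre (Suc m) (\<sigma> y))"
        using mem y S(2) by blast
      ultimately have "(F ^^ n) y \<in> \<A> m (pre m (\<sigma> (\<phi> y)))"
        using n(2) pre by (metis image_subset_iff)
      moreover have "\<phi> y \<in> \<A> m (pre m (\<sigma> (\<phi> y)))"
        using mem y S(3) by blast
      ultimately have "dist ((F ^^ n) y) (\<phi> y) \<le> 1 / Suc M"
        using close unfolding m_def by blast
      then show ?thesis using M[of M] by simp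
    qed
    moreover have "n \<ge> N" using n(1) M[of m] by (simp add: m_def)
    ultimately show "\<exists>n\<ge>N. \<forall>y\<in>S. dist ((F ^^ n) y) (\<phi> y) < \<epsilon>" by blast
  qed
qed

subsection \<open>Continua\<close>

text \<open>Boundary bumping: the component of \<open>p\<close> in the closed ball meets the
  frontier of this ball relative to \<open>D\<close>, and a frontier point cannot lie in the open
  ball.\<close>

lemma subcontinuum_reaching_sphere:
  fixes D :: "'a::metric_space set"
  assumes "compact D" "connected D" "p \<in> D" "q \<in> D" "\<gamma> < dist p q" "\<gamma> \<ge> 0"
  obtains C y where "C \<subseteq> D" "compact C" "connected C" "C \<subseteq> cball p \<gamma>" "p \<in> C" "y \<in> C" "dist p y = \<gamma>"
proof -
  let ?X = "top_of_set D" and ?S = "D \<inter> cball p \<gamma>"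
  define C where "C = connected_component_of_set (subtopology ?X ?S) p"
  have S: "subtopology ?X ?S = top_of_set ?S"
    by (simp add: subtopology_subtopology)
  have "p \<in> ?S" using assms by simp
  then have comp: "C \<in> connected_components_of (subtopology ?X ?S)"
    unfolding C_def connected_components_of_def by (intro imageI) simp
  have "C \<inter> ?X frontier_of ?S \<noteq> {}"
  proof (rule boundary_bumping_theorem_closed[OF _ _ _ _ _ comp])
    show "connected_space ?X"
      using assms(2) by (simp flip: connectedin_topspace)
    show "compact_space ?X" using assms(1) by (intro compact_space_subtopology) simp
    show "Hausdorff_space ?X" by (intro Hausdorff_space_subtopology Hausdorff_space_euclidean)
    show "closedin ?X ?S" by (intro closedin_closed_Int closed_cball)
    show "?S \<noteq> topspace ?X" using assms by force
  qed
  then obtain y where y: "y \<in> C" "y \<in> ?X frontier_of ?S" by blast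
  have CS: "C \<subseteq> ?S"
    using connected_component_of_subset_topspace[of "subtopology ?X ?S" p] by (auto simp: C_def)
  have "dist p y = \<gamma>"
  proof (rule ccontr)
    assume "dist p y \<noteq> \<gamma>"
    then have "y \<in> D \<inter> ball p \<gamma>" using y(1) CS by auto
    moreover have "openin ?X (D \<inter> ball p \<gamma>)" by (intro openin_open_Int open_ball)
    moreover have "D \<inter> ball p \<gamma> \<subseteq> ?S" by auto
    ultimately have "y \<in> ?X interior_of ?S" using interior_of_maximal by blast
    then show False using y(2) by (simp add: frontier_of_def)
  qed
  moreover have "compact C"
  proof -
    have "closedin (top_of_set ?S) C"
      using closedin_connected_components_of[OF comp] S by simp
    moreover have "compact ?S" using assms(1) by (simp add: compact_Int_closed)
    ultimately show ?thesis using closedin_compact by blast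
  qed
  moreover have "connected C"
    using connectedin_connected_components_of[OF comp] by (simp add: S connectedin_subtopology)
  moreover have "p \<in> C"
    using \<open>p \<in> ?S\<close> by (simp add: C_def connected_component_of_refl)
  ultimately show thesis using that[of C y] CS y(1) by auto
qed

text \<open>In a compact Hausdorff space the components are the quasi-components, so points not
  joined by a subcontinuum are separated by a clopen set.\<close>

lemma clopen_between_components:
  fixes Y :: "'a::metric_space set"
  assumes "compact Y" "p \<in> Y" "q \<in> Y"
    and "\<And>C. C \<subseteq> Y \<Longrightarrow> compact C \<Longrightarrow> connected C \<Longrightarrow> p \<in> C \<Longrightarrow> q \<notin> C"
  obtains U V where "compact U" "compact V" "U \<inter> V = {}" "U \<union> V = Y" "p \<in> U" "q \<in> V"
proof -
  let ?X = "top_of_set Y"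
  have X: "compact_space ?X" "Hausdorff_space ?X"
    using assms(1) by (auto intro: compact_space_subtopology Hausdorff_space_subtopology)
  define C where "C = connected_component_of_set ?X p"
  have comp: "C \<in> connected_components_of ?X"
    unfolding C_def connected_components_of_def using assms(2) by simp
  have "C \<subseteq> Y"
    using connected_component_of_subset_topspace[of ?X p] by (simp add: C_def)
  moreover have "compact C"
    using closedin_connected_components_of[OF comp] assms(1) closedin_compact by blast
  moreover have "connected C"
    using connectedin_connected_components_of[OF comp] by (simp add: connectedin_subtopology)
  moreover have "p \<in> C"
    using assms(2) by (simp add: C_def connected_component_of_refl)
  ultimately have "q \<notin> C" using assms(4) by blast
  then have "\<not> quasi_component_of ?X p q"
    using quasi_eq_connected_component_of[of ?X p] X by (simp add: C_def)
  then obtain T where T: "closedin ?X T" "openin ?X T" "p \<in> T" "q \<notin> T"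
    using assms(2,3) unfolding quasi_component_of_def
    by (metis Diff_iff closedin_def openin_closedin_eq topspace_euclidean_subtopology)
  have "closedin ?X (Y - T)" using T(2) by (metis openin_closedin_eq topspace_euclidean_subtopology)
  then have "compact T" "compact (Y - T)"
    using T(1) assms(1) closedin_compact by blast+
  moreover have "T \<subseteq> Y" using T(1) closedin_imp_subset by blast
  ultimately show thesis using that[of T "Y - T"] T(3,4) assms(3) by blast
qed

text \<open>A failure for every \<open>N\<close> would produce in the limit a continuum joining two points, all of
  whose images stay within \<open>c/2\<close> of the image of one of its points.\<close>

lemma uniform_separation_of_continua:
  fixes H :: "'a::metric_space set" and T :: "nat \<Rightarrow> 'a \<Rightarrow> 'b::metric_space"
  assumes "compact H" and cont: "\<And>n. continuous_on H (T n)"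
    and exp: "\<And>A x y. A \<subseteq> H \<Longrightarrow> compact A \<Longrightarrow> connected A \<Longrightarrow> x \<in> A \<Longrightarrow> y \<in> A \<Longrightarrow> x \<noteq> y \<Longrightarrow>
                \<exists>n. \<exists>u\<in>A. \<exists>v\<in>A. c < dist (T n u) (T n v)"
    and "\<gamma> > 0"
  shows "\<exists>N. \<forall>A\<subseteq>H. connected A \<longrightarrow> (\<exists>x\<in>A. \<exists>y\<in>A. \<gamma> \<le> dist x y) \<longrightarrow>
           (\<exists>n\<le>N. \<exists>u\<in>A. \<exists>v\<in>A. c / 2 < dist (T n u) (T n v))"
proof (rule ccontr)
  define sep where "sep N A \<longleftrightarrow> (\<exists>n\<le>N. \<exists>u\<in>A. \<exists>v\<in>A. c / 2 < dist (T n u) (T n v))" for N A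
  assume "\<not> ?thesis"
  then have "\<not> (\<exists>N. \<forall>A\<subseteq>H. connected A \<longrightarrow> (\<exists>x\<in>A. \<exists>y\<in>A. \<gamma> \<le> dist x y) \<longrightarrow> sep N A)"
    by (simp only: sep_def not_False_eq_True)
  then have "\<forall>N. \<exists>A x y. A \<subseteq> H \<and> connected A \<and> x \<in> A \<and> y \<in> A \<and> \<gamma> \<le> dist x y \<and> \<not> sep N A"
    by blast
  then have "\<forall>N. \<exists>A x y. A \<subseteq> H \<and> connected A \<and> x \<in> A \<and> y \<in> A \<and> \<gamma> \<le> dist x y \<and>
      (\<forall>n\<le>N. \<forall>u\<in>A. \<forall>v\<in>A. dist (T n u) (T n v) \<le> c / 2)"
    by (simp add: sep_def not_less)
  then obtain A0 p0 q0 where A0: "\<And>N. A0 N \<subseteq> H" "\<And>N. connected (A0 N)" "\<And>N. p0 N \<in> A0 N"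
    "\<And>N. q0 N \<in> A0 N" "\<And>N. \<gamma> \<le> dist (p0 N) (q0 N)"
    "\<And>N n u v. n \<le> N \<Longrightarrow> u \<in> A0 N \<Longrightarrow> v \<in> A0 N \<Longrightarrow> dist (T n u) (T n v) \<le> c / 2"
    by metis
  have pq0: "\<forall>N. (p0 N, q0 N) \<in> H \<times> H" using A0(1,3,4) by blast
  obtain l r where l: "l \<in> H \<times> H" and r: "strict_mono (r :: nat \<Rightarrow> nat)"
    and lim: "((\<lambda>N. (p0 N, q0 N)) \<circ> r) \<longlonglongrightarrow> l"
    by (rule seq_compactE[OF compact_imp_seq_compact[OF compact_Times[OF assms(1,1)]] pq0])
  define A p' q' where "A = A0 \<circ> r" and "p' = p0 \<circ> r" and "q' = q0 \<circ> r"
  define p q where "p = fst l" and "q = snd l"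
  have p: "p' \<longlonglongrightarrow> p" and q: "q' \<longlonglongrightarrow> q" and "p \<in> H" "q \<in> H"
    using tendsto_fst[OF lim] tendsto_snd[OF lim] l by (auto simp: p'_def q'_def p_def q_def o_def)
  have A: "\<And>k. A k \<subseteq> H" "\<And>k. connected (A k)" "\<And>k. p' k \<in> A k" "\<And>k. q' k \<in> A k"
    "\<And>k. \<gamma> \<le> dist (p' k) (q' k)"
    using A0 by (auto simp: A_def p'_def q'_def)
  have small: "dist (T n u) (T n v) \<le> c / 2" if "n \<le> k" "u \<in> A k" "v \<in> A k" for n k u v
    using A0(6)[of n "r k" u v] that seq_suble[OF r, of k] by (simp add: A_def)
  have "\<gamma> \<le> dist p q"
    by (rule tendsto_lowerbound[OF tendsto_dist[OF p q]]) (use A(5) in auto)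
  then have "p \<noteq> q" using \<open>\<gamma> > 0\<close> by auto
  \<comment> \<open>Comparing all images with those of the single point \<open>p\<close> gives a
    condition that passes to limits. Two points of \<open>Y\<close> stay within \<open>c\<close> of
    each other at all times, which \<open>exp\<close> forbids for a continuum joining
    \<open>p\<close> and \<open>q\<close>.\<close>
  define Y where "Y = {y\<in>H. \<forall>n. dist (T n y) (T n p) \<le> c / 2}"
  have limY: "b \<in> Y" if s: "strict_mono s" and bA: "\<And>k. \<beta> k \<in> A (s k)" and b: "\<beta> \<longlonglongrightarrow> b" for s \<beta> b
  proof -
    have \<beta>H: "\<beta> k \<in> H" for k using A(1) bA by blast
    have bH: "b \<in> H"
      using closed_sequentially[OF compact_imp_closed[OF assms(1)]] \<beta>H b by blast
    moreover have "dist (T n b) (T n p) \<le> c / 2" for n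
    proof -
      have "(\<lambda>k. T n (\<beta> k)) \<longlonglongrightarrow> T n b"
        by (rule continuous_on_tendsto_compose[OF cont b bH]) (simp add: \<beta>H)
      moreover have "(\<lambda>k. T n (p' (s k))) \<longlonglongrightarrow> T n p"
      proof (rule continuous_on_tendsto_compose[OF cont _ \<open>p \<in> H\<close>])
        show "(\<lambda>k. p' (s k)) \<longlonglongrightarrow> p"
          using LIMSEQ_subseq_LIMSEQ[OF p s] by (simp add: o_def)
        show "\<forall>\<^sub>F k in sequentially. p' (s k) \<in> H"
          by (rule always_eventually) (use A(1,3) in blast)
      qed
      ultimately have "(\<lambda>k. dist (T n (\<beta> k)) (T n (p' (s k)))) \<longlonglongrightarrow> dist (T n b) (T n p)"
        by (rule tendsto_dist)
      moreover have "\<forall>\<^sub>F k in sequentially. dist (T n (\<beta> k)) (T n (p' (s k))) \<le> c / 2"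
      proof (rule eventually_sequentiallyI)
        fix k assume "n \<le> k"
        then have "n \<le> s k" using seq_suble[OF s, of k] by linarith
        then show "dist (T n (\<beta> k)) (T n (p' (s k))) \<le> c / 2" using small bA A(3) by blast
      qed
      ultimately show ?thesis by (rule tendsto_upperbound) simp
    qed
    ultimately show ?thesis by (simp add: Y_def)
  qed
  have "strict_mono (\<lambda>k::nat. k)" by (simp add: strict_mono_def)
  then have pY: "p \<in> Y" and qY: "q \<in> Y"
    using limY[of "\<lambda>k. k" p' p] limY[of "\<lambda>k. k" q' q] A(3,4) p q by simp_all
  have "compact Y"
  proof -
    have "closed (H \<inter> T n -` cball (T n p) (c / 2))" for n
      by (intro continuous_closed_preimage cont compact_imp_closed assms(1) closed_cball)
    then have "closed (\<Inter>n. H \<inter> T n -` cball (T n p) (c / 2))" by blast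
    moreover have "Y = H \<inter> (\<Inter>n. H \<inter> T n -` cball (T n p) (c / 2))"
      by (auto simp: Y_def dist_commute)
    ultimately show ?thesis using compact_Int_closed[OF assms(1)] by metis
  qed
  have noC: "q \<notin> C" if C: "C \<subseteq> Y" "compact C" "connected C" "p \<in> C" for C
  proof
    assume "q \<in> C"
    have "C \<subseteq> H" using C(1) by (auto simp: Y_def)
    from exp[OF this C(2,3,4) \<open>q \<in> C\<close> \<open>p \<noteq> q\<close>] obtain n u v where
      uv: "u \<in> C" "v \<in> C" "c < dist (T n u) (T n v)" by blast
    then have "dist (T n u) (T n p) \<le> c / 2" "dist (T n v) (T n p) \<le> c / 2"
      using C(1) by (auto simp: Y_def)
    then show False
      using uv(3) dist_triangle2[of "T n u" "T n v" "T n p"] by simp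
  qed
  obtain U V where UV: "compact U" "compact V" "U \<inter> V = {}" "U \<union> V = Y" "p \<in> U" "q \<in> V"
    using clopen_between_components[OF \<open>compact Y\<close> pY qY noC] by blast
  obtain U' V' where U'V': "open U'" "open V'" "U \<subseteq> U'" "V \<subseteq> V'" "U' \<inter> V' = {}"
    using t4_space[OF compact_imp_closed[OF UV(1)] compact_imp_closed[OF UV(2)] UV(3)] by blast
  have "\<forall>\<^sub>F k in sequentially. p' k \<in> U'" "\<forall>\<^sub>F k in sequentially. q' k \<in> V'"
    using topological_tendstoD[OF p U'V'(1)] topological_tendstoD[OF q U'V'(2)] UV(5,6) U'V'(3,4) by auto
  then have "\<forall>\<^sub>F k in sequentially. p' k \<in> U' \<and> q' k \<in> V'" by (rule eventually_conj)
  then obtain k0 where k0: "\<And>k. k \<ge> k0 \<Longrightarrow> p' k \<in> U' \<and> q' k \<in> V'"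
    unfolding eventually_sequentially by blast
  \<comment> \<open>A connected set meeting two disjoint open sets has a point outside both. A limit
    of such points lies in \<open>Y\<close> but in neither half of it.\<close>
  have "\<exists>a\<in>A (k0 + k). a \<notin> U' \<union> V'" for k
  proof (rule ccontr)
    assume "\<not> ?thesis"
    then have "A (k0 + k) \<subseteq> U' \<union> V'" by blast
    moreover have "p' (k0 + k) \<in> U' \<inter> A (k0 + k)" "q' (k0 + k) \<in> V' \<inter> A (k0 + k)"
      using k0[of "k0 + k"] A(3,4) by auto
    ultimately show False
      using connectedD[OF A(2) U'V'(1,2), of "k0 + k"] U'V'(5) by blast
  qed
  then obtain \<alpha> where \<alpha>: "\<And>k. \<alpha> k \<in> A (k0 + k)" "\<And>k. \<alpha> k \<notin> U' \<union> V'" by metis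
  have "compact (H - (U' \<union> V'))" using assms(1) U'V'(1,2) by (intro compact_diff open_Un)
  then have sc: "seq_compact (H - (U' \<union> V'))" by (rule compact_imp_seq_compact)
  have \<alpha>H: "\<forall>k. \<alpha> k \<in> H - (U' \<union> V')" using \<alpha> A(1) by blast
  obtain a s where a: "a \<in> H - (U' \<union> V')" "strict_mono (s :: nat \<Rightarrow> nat)" "(\<alpha> \<circ> s) \<longlonglongrightarrow> a"
    by (rule seq_compactE[OF sc \<alpha>H])
  have "a \<in> Y"
  proof (rule limY)
    show "strict_mono (\<lambda>k. k0 + s k)" using a(2) by (simp add: strict_mono_def)
    show "(\<alpha> \<circ> s) k \<in> A (k0 + s k)" for k using \<alpha>(1) by simp
  qed (rule a(3))
  then show False using a(1) UV(4) U'V'(3,4) by blast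
qed

subsection \<open>Expansive homeomorphisms and shattered sets\<close>

text \<open>If a set \<open>J\<close> weighs \<open>t ^ card J\<close>, all subsets of
  \<open>E\<close> together weigh \<open>(1 + t) ^ card E\<close>, and each member of the family
  weighs at least \<open>t ^ d\<close>. No estimate of binomial sums is needed to find a large set
  in an exponentially large family.\<close>

lemma card_family_of_small_sets:
  fixes t :: real
  assumes "finite E" "\<J> \<subseteq> Pow E" "\<And>J. J \<in> \<J> \<Longrightarrow> card J \<le> d" "0 < t" "t \<le> 1"
  shows "real (card \<J>) * t ^ d \<le> (1 + t) ^ card E"
proof -
  have "real (card \<J>) * t ^ d = (\<Sum>J\<in>\<J>. t ^ d)" by simp
  also have "\<dots> \<le> (\<Sum>J\<in>\<J>. t ^ card J)"
    using assms(3-5) by (intro sum_mono power_decreasing) auto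
  also have "\<dots> \<le> (\<Sum>J\<in>Pow E. t ^ card J)"
    using assms(1,2,4) by (intro sum_mono2) auto
  also have "\<dots> = (\<Prod>x\<in>E. t + 1)"
    using prod_add[OF assms(1), of "\<lambda>_. t" "\<lambda>_. 1"] by simp
  finally show ?thesis by (simp add: add.commute)
qed

text \<open>Time reversal: started at \<open>(G ^^ (n + 1)) x\<close>, the orbit under
  \<open>F\<close> reaches \<open>(G ^^ t) x\<close> after \<open>n + 1 - t\<close> steps. The added
  1 keeps the reflected times in \<open>{1..n}\<close>.\<close>

lemma indep_on_reflect:
  assumes "indep_on H G A K J" "J \<subseteq> {1..n}" "G ` H \<subseteq> H" "\<And>x. x \<in> H \<Longrightarrow> F (G x) = x"
  shows "indep_on H F A K ((\<lambda>t. n + 1 - t) ` J)"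
  unfolding indep_on_def
proof (intro allI impI)
  have FG: "(F ^^ k) ((G ^^ k) x) = x" if "x \<in> H" for k x
    by (rule funpow_left_inverse[OF assms(3,4) that])
  fix w assume "w ` (\<lambda>t. n + 1 - t) ` J \<subseteq> K"
  then have "(\<lambda>t. w (n + 1 - t)) ` J \<subseteq> K" by auto
  from indep_onD[OF assms(1) this] obtain x where
    x: "x \<in> H" "\<And>t. t \<in> J \<Longrightarrow> (G ^^ t) x \<in> A (w (n + 1 - t))" by metis
  have "(F ^^ (n + 1 - t)) ((G ^^ (n + 1)) x) = (G ^^ t) x" if "t \<in> J" for t
  proof -
    have "t \<le> n" using assms(2) that by auto
    then have "(G ^^ (n + 1)) x = (G ^^ (n + 1 - t)) ((G ^^ t) x)"
      by (metis comp_apply funpow_add le_add_diff_inverse2 trans_le_add1)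
    then show ?thesis using FG funpow_invariant[OF assms(3) x(1)] by simp
  qed
  moreover have "(G ^^ (n + 1)) x \<in> H" using funpow_invariant[OF assms(3) x(1)] .
  ultimately show "\<exists>x\<in>H. \<forall>j\<in>(\<lambda>t. n + 1 - t) ` J. (F ^^ j) x \<in> A (w j)"
    using x(2) by (intro bexI[of _ "(G ^^ (n + 1)) x"]) (auto simp del: funpow.simps)
qed

text \<open>The expansivity constant is written \<open>2 * d\<close> because its uniform version
  over continua loses half. The two directions of time are kept apart, since a continuum that stays
  small under \<open>F\<close> can only grow under \<open>G\<close>.\<close>

locale cw_system =
  fixes H :: "'a::metric_space set" and F G :: "'a \<Rightarrow> 'a" and d :: real
  assumes compact: "compact H" and homeo: "homeomorphism H H F G" and d_pos: "d > 0"
    and expansive: "\<And>A x y. A \<subseteq> H \<Longrightarrow> compact A \<Longrightarrow> connected A \<Longrightarrow> x \<in> A \<Longrightarrow> y \<in> A \<Longrightarrow> x \<noteq> y \<Longrightarrow>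
       \<exists>n. \<exists>u\<in>A. \<exists>v\<in>A. 2 * d < dist ((F ^^ n) u) ((F ^^ n) v) \<or> 2 * d < dist ((G ^^ n) u) ((G ^^ n) v)"
begin

section \<open>Backward growth and branching of contracted continua\<close>

lemma F: "F ` H \<subseteq> H" "continuous_on H F" and G: "G ` H \<subseteq> H" "continuous_on H G"
  and FG: "x \<in> H \<Longrightarrow> F (G x) = x" and GF: "x \<in> H \<Longrightarrow> G (F x) = x"
  using homeo unfolding homeomorphism_def by auto

lemma funpow_F_G: "x \<in> H \<Longrightarrow> (F ^^ n) ((G ^^ n) x) = x"
  by (rule funpow_left_inverse[OF G(1) FG])

lemma funpow_G_F: "x \<in> H \<Longrightarrow> (G ^^ n) ((F ^^ n) x) = x"
  by (rule funpow_left_inverse[OF F(1) GF])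

text \<open>A bound by \<open>d\<close> at all future times replaces contraction to 0; against the
  expansivity constant \<open>2 * d\<close> it already forces a nondegenerate continuum to grow
  under \<open>G\<close>.\<close>

definition thin :: "'a set \<Rightarrow> bool" where
  "thin A \<longleftrightarrow> A \<subseteq> H \<and> compact A \<and> connected A \<and>
     (\<forall>n. \<forall>x\<in>A. \<forall>y\<in>A. dist ((F ^^ n) x) ((F ^^ n) y) \<le> d)"

definition fat :: "'a set \<Rightarrow> bool" where
  "fat A \<longleftrightarrow> (\<exists>x\<in>A. \<exists>y\<in>A. d / 8 \<le> dist x y)"

text \<open>Let \<open>e\<close> be a net point within \<open>d / 8\<close> of \<open>p\<close>, and
  \<open>dist p q > d\<close>. Pieces of radius \<open>d / 8\<close> around \<open>p\<close> and
  \<open>q\<close> then lie at distance at most \<open>d / 4\<close> and at least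
  \<open>3 * d / 4\<close> from \<open>e\<close>. Centres in a finite net leave only finitely many
  such pairs of sets.\<close>

definition near :: "'a \<Rightarrow> 'a set" where "near e = {y\<in>H. dist e y \<le> d / 4}"

definition far :: "'a \<Rightarrow> 'a set" where "far e = {y\<in>H. 3 * d / 4 \<le> dist e y}"

lemma near_far: "closed (near e)" "closed (far e)" "near e \<inter> far e = {}"
proof -
  have "near e = H \<inter> cball e (d / 4)" by (auto simp: near_def)
  then show "closed (near e)" using compact by (simp add: closed_Int compact_imp_closed)
  have "far e = H - ball e (3 * d / 4)" by (auto simp: far_def)
  then show "closed (far e)" using compact by (simp add: closed_Diff compact_imp_closed)
  show "near e \<inter> far e = {}" using d_pos by (auto simp: near_def far_def)
qed

text \<open>At the first time \<open>n\<close> at which the image of \<open>A\<close> under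
  \<open>G ^^ n\<close> exceeds \<open>d\<close>, this image \<open>D\<close> is large at time 0
  only: its images under \<open>F\<close> are earlier images of \<open>A\<close> under
  \<open>G\<close>, small by minimality, and then images of \<open>A\<close> under \<open>F\<close>,
  small since \<open>A\<close> is thin. So every subcontinuum of \<open>D\<close> of diameter at
  most \<open>d\<close> is thin, and two of them can be cut out around points more than
  \<open>d\<close> apart.\<close>

lemma branching:
  assumes "thin A" "x \<in> A" "y \<in> A" "d < dist ((G ^^ N) x) ((G ^^ N) y)"
    and net: "H \<subseteq> (\<Union>e\<in>E. cball e (d / 8))"
  shows "\<exists>n\<in>{1..N}. \<exists>e\<in>E. \<exists>C1 C2. thin C1 \<and> fat C1 \<and> thin C2 \<and> fat C2 \<and>
           (F ^^ n) ` C1 \<subseteq> A \<and> (F ^^ n) ` C2 \<subseteq> A \<and> C1 \<subseteq> near e \<and> C2 \<subseteq> far e"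
proof -
  have A: "A \<subseteq> H" "compact A" "connected A"
    and small: "\<And>n x y. x \<in> A \<Longrightarrow> y \<in> A \<Longrightarrow> dist ((F ^^ n) x) ((F ^^ n) y) \<le> d"
    using assms(1) by (auto simp: thin_def)
  let ?R = "\<lambda>n. \<exists>x\<in>A. \<exists>y\<in>A. d < dist ((G ^^ n) x) ((G ^^ n) y)"
  define n where "n = (LEAST n. ?R n)"
  have "?R N" using assms by blast
  then have "?R n" and "n \<le> N" unfolding n_def by (rule LeastI, rule Least_le)
  have least: "dist ((G ^^ k) x) ((G ^^ k) y) \<le> d" if "k < n" "x \<in> A" "y \<in> A" for k x y
    using not_less_Least[of k ?R] that unfolding n_def by (meson not_le)
  have "n \<noteq> 0"
  proof
    assume "n = 0"
    then show False using \<open>?R n\<close> small[of _ _ 0] by force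
  qed
  define D where "D = (G ^^ n) ` A"
  have cont: "continuous_on A (G ^^ n)"
    using continuous_on_funpow[OF G] A(1) continuous_on_subset by blast
  have D: "compact D" "connected D" "D \<subseteq> H"
    unfolding D_def using compact_continuous_image[OF cont A(2)]
      connected_continuous_image[OF cont A(3)] funpow_invariant[OF G(1)] A(1) by auto
  obtain p q where pq: "p \<in> D" "q \<in> D" "d < dist p q"
    using \<open>?R n\<close> unfolding D_def by blast
  have FD: "(F ^^ n) ` D \<subseteq> A"
    unfolding D_def using funpow_F_G A(1) by (auto simp: subset_iff)
  have later: "dist ((F ^^ i) u) ((F ^^ i) v) \<le> d" if "i \<noteq> 0" "u \<in> D" "v \<in> D" for i u v
  proof -
    obtain a b where ab: "a \<in> A" "u = (G ^^ n) a" "b \<in> A" "v = (G ^^ n) b"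
      using \<open>u \<in> D\<close> \<open>v \<in> D\<close> unfolding D_def by blast
    show ?thesis
    proof (cases "i \<le> n")
      case True
      have "(F ^^ i) ((G ^^ n) z) = (G ^^ (n - i)) z" if "z \<in> A" for z
      proof -
        have "(G ^^ n) z = (G ^^ i) ((G ^^ (n - i)) z)"
          using True by (metis comp_apply funpow_add le_add_diff_inverse)
        then show ?thesis
          using funpow_F_G[OF funpow_invariant[OF G(1)]] that A(1) by (simp add: subset_iff)
      qed
      then show ?thesis using ab least[of "n - i" a b] \<open>i \<noteq> 0\<close> \<open>n \<noteq> 0\<close> by simp
    next
      case False
      have "(F ^^ i) ((G ^^ n) z) = (F ^^ (i - n)) z" if "z \<in> A" for z
      proof -
        have "(F ^^ i) ((G ^^ n) z) = (F ^^ (i - n)) ((F ^^ n) ((G ^^ n) z))"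
          using False by (metis comp_apply funpow_add le_add_diff_inverse2 nat_le_linear)
        then show ?thesis using funpow_F_G that A(1) by (simp add: subset_iff)
      qed
      then show ?thesis using ab small[of a b "i - n"] by simp
    qed
  qed
  have piece: "\<exists>C\<subseteq>D. C \<subseteq> cball p (d / 8) \<and> thin C \<and> fat C"
    if pq: "p \<in> D" "q \<in> D" "d < dist p q" for p q
  proof -
    have "d / 8 < dist p q" "0 \<le> d / 8" using pq(3) d_pos by auto
    then obtain C y where C: "C \<subseteq> D" "compact C" "connected C" "C \<subseteq> cball p (d / 8)" "p \<in> C" "y \<in> C"
      "dist p y = d / 8"
      by (rule subcontinuum_reaching_sphere[OF D(1,2) pq(1,2)])
    have "dist ((F ^^ i) u) ((F ^^ i) v) \<le> d" if "u \<in> C" "v \<in> C" for i u v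
    proof (cases "i = 0")
      case True
      have "dist p u \<le> d / 8" "dist p v \<le> d / 8" using that C(4) by auto
      then have "dist u v \<le> d" using dist_triangle3[of u v p] d_pos by linarith
      then show ?thesis using True by simp
    next
      case False
      then show ?thesis using later C(1) that by blast
    qed
    then have "thin C" using C(1-3) D(3) by (auto simp: thin_def)
    moreover have "fat C" using C(5-7) by (auto simp: fat_def)
    ultimately show ?thesis using C(1,4) by blast
  qed
  obtain C1 where C1: "C1 \<subseteq> D" "C1 \<subseteq> cball p (d / 8)" "thin C1" "fat C1"
    using piece[OF pq] by blast
  have "d < dist q p" using pq(3) by (simp add: dist_commute)
  then obtain C2 where C2: "C2 \<subseteq> D" "C2 \<subseteq> cball q (d / 8)" "thin C2" "fat C2"
    using piece[OF pq(2,1)] by blast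
  have "p \<in> (\<Union>e\<in>E. cball e (d / 8))" using D(3) pq(1) by (intro subsetD[OF net]) blast
  then obtain e where e: "e \<in> E" "dist e p \<le> d / 8" by auto
  have "C1 \<subseteq> near e"
  proof
    fix y assume y: "y \<in> C1"
    then have "dist p y \<le> d / 8" using C1(2) by auto
    then have "dist e y \<le> d / 4" using dist_triangle[of e y p] e(2) by linarith
    then show "y \<in> near e" using y C1(1) D(3) by (auto simp: near_def)
  qed
  moreover have "C2 \<subseteq> far e"
  proof
    fix y assume y: "y \<in> C2"
    then have "dist q y \<le> d / 8" using C2(2) by auto
    moreover have "dist p q \<le> dist e p + dist e y + dist q y"
      using dist_triangle3[of p q e] dist_triangle2[of e q y] by (simp add: dist_commute)
    ultimately have "3 * d / 4 \<le> dist e y" using pq(3) e(2) by linarith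
    then show "y \<in> far e" using y C2(1) D(3) by (auto simp: far_def)
  qed
  moreover have "(F ^^ n) ` C1 \<subseteq> A" "(F ^^ n) ` C2 \<subseteq> A" using FD C1(1) C2(1) by blast+
  moreover have "n \<in> {1..N}" using \<open>n \<noteq> 0\<close> \<open>n \<le> N\<close> by simp
  ultimately show ?thesis using C1(3,4) C2(3,4) e(1) by blast
qed

text \<open>Forward and backward iterates are interleaved into one sequence, for which the
  separation time of all continua of diameter at least \<open>d / 8\<close> is bounded. A thin
  continuum is never separated forwards, so that time belongs to \<open>G\<close>.\<close>

lemma uniform_growth:
  "\<exists>N. \<forall>A. thin A \<longrightarrow> fat A \<longrightarrow> (\<exists>n\<le>N. \<exists>u\<in>A. \<exists>v\<in>A. d < dist ((G ^^ n) u) ((G ^^ n) v))"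
proof -
  define T where "T n = (if even n then F ^^ (n div 2) else G ^^ (n div 2))" for n :: nat
  have cont: "continuous_on H (T n)" for n
    using continuous_on_funpow[OF F] continuous_on_funpow[OF G] by (simp add: T_def)
  have exp: "\<exists>n. \<exists>u\<in>A. \<exists>v\<in>A. 2 * d < dist (T n u) (T n v)"
    if A: "A \<subseteq> H" "compact A" "connected A" "x \<in> A" "y \<in> A" "x \<noteq> y" for A x y
  proof -
    obtain n u v where "u \<in> A" "v \<in> A"
      "2 * d < dist ((F ^^ n) u) ((F ^^ n) v) \<or> 2 * d < dist ((G ^^ n) u) ((G ^^ n) v)"
      using expansive[OF A] by blast
    moreover have "T (2 * n) = F ^^ n" "T (Suc (2 * n)) = G ^^ n" by (simp_all add: T_def)
    ultimately show ?thesis by metis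
  qed
  have "d / 8 > 0" using d_pos by simp
  from uniform_separation_of_continua[OF compact cont exp this]
  obtain N where N: "\<forall>A\<subseteq>H. connected A \<longrightarrow> (\<exists>x\<in>A. \<exists>y\<in>A. d / 8 \<le> dist x y) \<longrightarrow>
           (\<exists>n\<le>N. \<exists>u\<in>A. \<exists>v\<in>A. 2 * d / 2 < dist (T n u) (T n v))"
    by (rule exE)
  have "\<exists>n\<le>N. \<exists>u\<in>A. \<exists>v\<in>A. d < dist ((G ^^ n) u) ((G ^^ n) v)" if A: "thin A" "fat A" for A
  proof -
    have "A \<subseteq> H" "connected A" "\<exists>x\<in>A. \<exists>y\<in>A. d / 8 \<le> dist x y"
      using A by (auto simp: thin_def fat_def)
    then obtain n u v where n: "n \<le> N" "u \<in> A" "v \<in> A" "2 * d / 2 < dist (T n u) (T n v)"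
      using N by blast
    have "odd n"
    proof
      assume "even n"
      then have "dist (T n u) (T n v) \<le> d" using A(1) n(2,3) by (simp add: T_def thin_def)
      then show False using n(4) by simp
    qed
    then have "d < dist ((G ^^ (n div 2)) u) ((G ^^ (n div 2)) v)" using n(4) by (simp add: T_def)
    moreover have "n div 2 \<le> N" using n(1) by linarith
    ultimately show ?thesis using n(2,3) by blast
  qed
  then show ?thesis by blast
qed

text \<open>Each time carries a net point as label, because the pair of sets to be visited depends
  on it; one time may occur with several labels.\<close>

definition shattered :: "'a set \<Rightarrow> ('a \<times> nat) set \<Rightarrow> bool" where
  "shattered A J \<longleftrightarrow> (\<forall>w. \<exists>x\<in>A. \<forall>(e, t)\<in>J. (G ^^ t) x \<in> (if w (e, t) then near e else far e))"

lemma shattered_shift: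
  assumes "shattered C J" "C \<subseteq> H" "(F ^^ n) ` C \<subseteq> A"
  shows "shattered A ((\<lambda>(e, t). (e, t + n)) ` J)"
  unfolding shattered_def
proof
  fix w
  obtain x where x: "x \<in> C" "\<And>e t. (e, t) \<in> J \<Longrightarrow> (G ^^ t) x \<in> (if w (e, t + n) then near e else far e)"
    using assms(1)[unfolded shattered_def, rule_format, of "\<lambda>(e, t). w (e, t + n)"] by fastforce
  have Gt: "(G ^^ (t + n)) ((F ^^ n) x) = (G ^^ t) x" for t
    using funpow_G_F[of x n] x(1) assms(2) by (auto simp: funpow_add)
  have "(G ^^ s) ((F ^^ n) x) \<in> (if w (e, s) then near e else far e)"
    if es: "(e, s) \<in> (\<lambda>(e, t). (e, t + n)) ` J" for e s
  proof -
    obtain t where "(e, t) \<in> J" "s = t + n" using es by auto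
    then show ?thesis using x(2)[of e t] Gt[of t] by simp
  qed
  then show "\<exists>x\<in>A. \<forall>(e, t)\<in>(\<lambda>(e, t). (e, t + n)) ` J. (G ^^ t) x \<in> (if w (e, t) then near e else far e)"
    using x(1) assms(3) by (intro bexI[of _ "(F ^^ n) x"]) blast+
qed

text \<open>The word's value at the new label decides from which branch the point is taken:
  \<open>G ^^ n\<close> leads back into \<open>C1\<close> or \<open>C2\<close>, and either branch
  realizes whatever is asked at the later times.\<close>

lemma shattered_insert:
  assumes "shattered C1 J" "shattered C2 J" "C1 \<subseteq> near e" "C2 \<subseteq> far e"
    "(F ^^ n) ` C1 \<subseteq> A" "(F ^^ n) ` C2 \<subseteq> A"
  shows "shattered A (insert (e, n) ((\<lambda>(e, t). (e, t + n)) ` J))"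
  unfolding shattered_def
proof
  fix w
  define C where "C = (if w (e, n) then C1 else C2)"
  have C: "shattered C J" "C \<subseteq> H" "(F ^^ n) ` C \<subseteq> A" "C \<subseteq> (if w (e, n) then near e else far e)"
    using assms by (auto simp: C_def near_def far_def)
  have "shattered ((F ^^ n) ` C) ((\<lambda>(e, t). (e, t + n)) ` J)"
    using shattered_shift[OF C(1,2) order_refl] .
  then obtain y where y: "y \<in> (F ^^ n) ` C"
    "\<forall>(e, t)\<in>(\<lambda>(e, t). (e, t + n)) ` J. (G ^^ t) y \<in> (if w (e, t) then near e else far e)"
    unfolding shattered_def by blast
  obtain x where x: "x \<in> C" "y = (F ^^ n) x" using y(1) by blast
  have "x \<in> H" using x(1) C(2) by blast
  then have "(G ^^ n) y \<in> (if w (e, n) then near e else far e)"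
    using funpow_G_F x C(4) by auto
  have all: "(\<lambda>(e, t). (G ^^ t) y \<in> (if w (e, t) then near e else far e)) z"
    if "z \<in> insert (e, n) ((\<lambda>(e, t). (e, t + n)) ` J)" for z
    using that
  proof (rule insertE)
    assume "z = (e, n)"
    then show ?thesis
      using \<open>(G ^^ n) y \<in> (if w (e, n) then near e else far e)\<close> by simp
  next
    assume "z \<in> (\<lambda>(e, t). (e, t + n)) ` J"
    then show ?thesis using y(2) by (rule bspec[rotated])
  qed
  have yA: "y \<in> A" using y(1) C(3) by blast
  show "\<exists>x\<in>A. \<forall>(e, t)\<in>insert (e, n) ((\<lambda>(e, t). (e, t + n)) ` J).
      (G ^^ t) x \<in> (if w (e, t) then near e else far e)"
  proof (rule bexI[OF _ yA])
    show "\<forall>(e, t)\<in>insert (e, n) ((\<lambda>(e, t). (e, t + n)) ` J).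
      (G ^^ t) y \<in> (if w (e, t) then near e else far e)"
      by (rule ballI) (erule all)
  qed
qed

text \<open>Going backwards, a thin fat continuum branches into two of its kind within bounded time.
  As in Pajor's proof of the Sauer--Shelah lemma, a set shattered by both branches is shattered
  by their parent with and without the label of the branching, so the number of shattered sets at
  least doubles at each step.\<close>

lemma many_shattered_sets:
  assumes N: "\<And>A. thin A \<Longrightarrow> fat A \<Longrightarrow> \<exists>n\<le>N. \<exists>u\<in>A. \<exists>v\<in>A. d < dist ((G ^^ n) u) ((G ^^ n) v)"
    and E: "finite E" "H \<subseteq> (\<Union>e\<in>E. cball e (d / 8))"
    and "thin A" "fat A"
  shows "\<exists>\<J>. \<J> \<subseteq> Pow (E \<times> {1..N * k}) \<and> 2 ^ k \<le> card \<J> \<and> (\<forall>J\<in>\<J>. shattered A J)"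
  using assms(4,5)
proof (induction k arbitrary: A)
  case 0
  then have "shattered A {}" by (auto simp: shattered_def fat_def)
  then show ?case by (intro exI[of _ "{{}}"]) auto
next
  case (Suc k)
  obtain n0 u v where uv: "n0 \<le> N" "u \<in> A" "v \<in> A" "d < dist ((G ^^ n0) u) ((G ^^ n0) v)"
    using N[OF Suc.prems] by blast
  obtain n e C1 C2 where n: "n \<in> {1..n0}" and e: "e \<in> E" and C: "thin C1" "fat C1" "thin C2" "fat C2"
    "(F ^^ n) ` C1 \<subseteq> A" "(F ^^ n) ` C2 \<subseteq> A" "C1 \<subseteq> near e" "C2 \<subseteq> far e"
    using branching[OF Suc.prems(1) uv(2,3,4) E(2)] by blast
  obtain \<J>1 where J1: "\<J>1 \<subseteq> Pow (E \<times> {1..N * k})" "2 ^ k \<le> card \<J>1" "\<forall>J\<in>\<J>1. shattered C1 J"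
    using Suc.IH[OF C(1,2)] by (elim exE conjE) (rule that)
  obtain \<J>2 where J2: "\<J>2 \<subseteq> Pow (E \<times> {1..N * k})" "2 ^ k \<le> card \<J>2" "\<forall>J\<in>\<J>2. shattered C2 J"
    using Suc.IH[OF C(3,4)] by (elim exE conjE) (rule that)
  define sh where "sh J = (\<lambda>(e :: 'a, t). (e, t + n)) ` J" for J
  have fin: "finite \<J>1" "finite \<J>2"
    using finite_subset[OF J1(1)] finite_subset[OF J2(1)] E(1) by simp_all
  have "inj (\<lambda>(e :: 'a, t). (e, t + n))" by (auto simp: inj_def)
  then have inj: "inj sh" by (intro injI) (simp add: sh_def inj_image_eq_iff)
  \<comment> \<open>The old times are at least 1, so after the shift they exceed \<open>n\<close>
    and the new label is fresh.\<close>
  have new: "(e, n) \<notin> sh J" if "J \<in> \<J>1 \<union> \<J>2" for J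
    using that J1(1) J2(1) by (force simp: sh_def)
  define \<J> where "\<J> = sh ` (\<J>1 \<union> \<J>2) \<union> (\<lambda>J. insert (e, n) (sh J)) ` (\<J>1 \<inter> \<J>2)"
  have "inj_on (\<lambda>J. insert (e, n) (sh J)) (\<J>1 \<inter> \<J>2)"
  proof (rule inj_onI)
    fix J J' assume "J \<in> \<J>1 \<inter> \<J>2" "J' \<in> \<J>1 \<inter> \<J>2" "insert (e, n) (sh J) = insert (e, n) (sh J')"
    then have "sh J = sh J'" using new by (metis Int_iff Un_iff insert_ident)
    then show "J = J'" using inj by (simp add: inj_eq)
  qed
  then have c2: "card ((\<lambda>J. insert (e, n) (sh J)) ` (\<J>1 \<inter> \<J>2)) = card (\<J>1 \<inter> \<J>2)"
    by (rule card_image)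
  have c1: "card (sh ` (\<J>1 \<union> \<J>2)) = card (\<J>1 \<union> \<J>2)"
    using inj_on_subset[OF inj subset_UNIV] by (rule card_image)
  have "card \<J> = card (sh ` (\<J>1 \<union> \<J>2)) + card ((\<lambda>J. insert (e, n) (sh J)) ` (\<J>1 \<inter> \<J>2))"
    unfolding \<J>_def using fin new by (intro card_Un_disjoint) auto
  also have "\<dots> = card \<J>1 + card \<J>2"
    unfolding c1 c2 using card_Un_Int[OF fin] by simp
  finally have "2 ^ Suc k \<le> card \<J>" using J1(2) J2(2) by simp
  moreover have "\<J> \<subseteq> Pow (E \<times> {1..N * Suc k})"
  proof -
    have "sh J \<subseteq> E \<times> {1..N * Suc k}" if "J \<in> \<J>1 \<union> \<J>2" for J
    proof -
      have "J \<subseteq> E \<times> {1..N * k}" using that J1(1) J2(1) by blast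
      then show ?thesis using n uv(1) by (fastforce simp: sh_def)
    qed
    moreover have "(e, n) \<in> E \<times> {1..N * Suc k}" using n uv(1) e by auto
    ultimately show ?thesis unfolding \<J>_def by auto
  qed
  moreover have "\<forall>J\<in>\<J>. shattered A J"
  proof -
    have "C1 \<subseteq> H" "C2 \<subseteq> H" using C(1,3) by (auto simp: thin_def)
    then have "shattered A (sh J)" if "J \<in> \<J>1 \<union> \<J>2" for J
      using that shattered_shift C(5,6) J1(3) J2(3) unfolding sh_def by blast
    moreover have "shattered A (insert (e, n) (sh J))" if "J \<in> \<J>1 \<inter> \<J>2" for J
      unfolding sh_def by (rule shattered_insert[of C1 _ C2]) (use that C J1(3) J2(3) in auto)
    ultimately show ?thesis unfolding \<J>_def by auto
  qed
  ultimately show ?case by blast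
qed

text \<open>Exponentially many shattered sets of labelled times force a shattered set of size
  proportional to \<open>k\<close>. Its commonest label costs a factor \<open>m\<close> and leaves a
  single pair of sets; reversing the window passes from \<open>G\<close> to
  \<open>F\<close>.\<close>

lemma shattered_imp_dense_indep:
  assumes N: "\<And>A. thin A \<Longrightarrow> fat A \<Longrightarrow> \<exists>n\<le>N. \<exists>u\<in>A. \<exists>v\<in>A. d < dist ((G ^^ n) u) ((G ^^ n) v)"
    and "N \<ge> 1" and E: "finite E" "E \<noteq> {}" "H \<subseteq> (\<Union>e\<in>E. cball e (d / 8))"
    and A: "thin A" "fat A"
  shows "\<exists>e\<in>E. dense_indep H F (\<lambda>b. if b then near e else far e) UNIV"
proof -
  define m where "m = card E"
  have m: "m \<ge> 1" using E(1,2) by (simp add: m_def Suc_leI card_gt_0_iff)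
  \<comment> \<open>With \<open>t = 1 / r\<close> the total weight of all subsets of the
    \<open>m * N * k\<close> labelled times is at most \<open>exp (k / 4)\<close>, less than
    \<open>2 ^ k\<close> for positive \<open>k\<close>. Taking logarithms gives the slope
    \<open>\<kappa>\<close>, and \<open>c\<close> relates it to the window length
    \<open>N * k\<close> and to one label.\<close>
  define r where "r = 4 * real m * real N"
  have "real m * real N \<ge> 1" using m assms(2) by (metis mult_le_mono nat_mult_1 of_nat_1 of_nat_le_iff of_nat_mult)
  then have r: "r \<ge> 4" by (simp add: r_def)
  have lnr: "ln r > 0" using r by simp
  define t where "t = 1 / r"
  have t: "0 < t" "t \<le> 1" using r by (auto simp: t_def)
  define \<kappa> where "\<kappa> = (ln 2 - 1 / 4) / ln r"
  have "\<kappa> > 0" unfolding \<kappa>_def using lnr ln2_ge_two_thirds by (intro divide_pos_pos) auto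
  define c where "c = \<kappa> / (real m * real N)"
  have "c > 0" using \<open>\<kappa> > 0\<close> m assms(2) by (simp add: c_def)
  have "\<exists>e\<in>E. \<exists>J\<subseteq>{1..N * k}. c * real (N * k) \<le> real (card J) \<and>
      indep_on H F (\<lambda>b. if b then near e else far e) UNIV J" for k
  proof -
    have "\<exists>\<J>. \<J> \<subseteq> Pow (E \<times> {1..N * k}) \<and> 2 ^ k \<le> card \<J> \<and> (\<forall>J\<in>\<J>. shattered A J)"
      by (rule many_shattered_sets[OF N E(1,3) A])
    then obtain \<J> where J: "\<J> \<subseteq> Pow (E \<times> {1..N * k})" "2 ^ k \<le> card \<J>" "\<forall>J\<in>\<J>. shattered A J"
      by (elim exE conjE) (rule that)
    have fin: "finite \<J>" using finite_subset[OF J(1)] E(1) by simp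
    have "card \<J> > 0" using J(2) by (metis less_le_trans pos2 zero_less_power)
    then have "\<J> \<noteq> {}" by auto
    have "Max (card ` \<J>) \<in> card ` \<J>" using fin \<open>\<J> \<noteq> {}\<close> by (intro Max_in) auto
    then obtain J0 where J0: "J0 \<in> \<J>" "card J0 = Max (card ` \<J>)" by auto
    have max: "card J' \<le> card J0" if "J' \<in> \<J>" for J' using that fin J0(2) by simp
    have J0E: "J0 \<subseteq> E \<times> {1..N * k}" using J0(1) J(1) by blast
    define D where "D = card J0"
    have "real (2 ^ k) \<le> real (card \<J>)" using J(2) of_nat_le_iff by blast
    then have "(2::real) ^ k * t ^ D \<le> real (card \<J>) * t ^ D"
      using t by (intro mult_right_mono) auto
    also have "\<dots> \<le> (1 + t) ^ card (E \<times> {1..N * k})"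
      by (rule card_family_of_small_sets[OF _ J(1)]) (use E(1) max t in \<open>auto simp: D_def\<close>)
    also have "card (E \<times> {1..N * k}) = m * (N * k)"
      by (simp add: card_cartesian_product m_def)
    also have "(1 + t) ^ (m * (N * k)) \<le> exp t ^ (m * (N * k))"
      using t by (intro power_mono) auto
    also have "\<dots> = exp (real (m * (N * k)) * t)" by (rule exp_of_nat_mult[symmetric])
    also have "real (m * (N * k)) * t = real k / 4"
      using m assms(2) by (simp add: t_def r_def)
    finally have "(2::real) ^ k * t ^ D \<le> exp (real k / 4)" .
    then have "ln ((2::real) ^ k * t ^ D) \<le> ln (exp (real k / 4))"
      using t by (subst ln_le_cancel_iff) auto
    then have "k * ln 2 - D * ln r \<le> real k / 4"
      using t r by (simp add: ln_mult ln_realpow t_def ln_div)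
    then have D: "\<kappa> * k \<le> D"
      using lnr by (simp add: \<kappa>_def field_simps)
    define Je where "Je e = {t. (e, t) \<in> J0}" for e
    have JeN: "Je e \<subseteq> {1..N * k}" for e using J0E by (auto simp: Je_def)
    have finJe: "finite (Je e)" for e using finite_subset[OF JeN] by simp
    have "\<exists>e\<in>E. real D / m \<le> card (Je e)"
    proof (rule ccontr)
      assume "\<not> ?thesis"
      then have "(\<Sum>e\<in>E. real (card (Je e))) < (\<Sum>e\<in>E. real D / m)"
        using E(1,2) by (intro sum_strict_mono) auto
      also have "\<dots> = D" using m by (simp add: m_def)
      also have "J0 = Sigma E Je" using J0E by (auto simp: Je_def)
      then have "D = (\<Sum>e\<in>E. card (Je e))"
        using E(1) finJe by (simp add: D_def card_SigmaI)
      finally show False by simp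
    qed
    then obtain e where e: "e \<in> E" "real D / m \<le> card (Je e)" by blast
    have "indep_on H G (\<lambda>b. if b then near e else far e) UNIV (Je e)"
      unfolding indep_on_def
    proof (intro allI impI)
      fix w :: "nat \<Rightarrow> bool"
      have "shattered A J0" using J(3) J0(1) by blast
      then obtain x where x: "x \<in> A"
        "\<forall>(e, t)\<in>J0. (G ^^ t) x \<in> (if (\<lambda>(e, t). w t) (e, t) then near e else far e)"
        unfolding shattered_def by blast
      have "x \<in> H" using x(1) A(1) by (auto simp: thin_def)
      moreover have "(G ^^ t) x \<in> (if w t then near e else far e)" if "t \<in> Je e" for t
        using x(2) that by (auto simp: Je_def)
      ultimately show "\<exists>x\<in>H. \<forall>t\<in>Je e. (G ^^ t) x \<in> (if w t then near e else far e)"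
        by blast
    qed
    then have ind: "indep_on H F (\<lambda>b. if b then near e else far e) UNIV ((\<lambda>t. N * k + 1 - t) ` Je e)"
      by (rule indep_on_reflect[OF _ JeN G(1) FG])
    have "inj_on (\<lambda>t. N * k + 1 - t) (Je e)"
      using JeN by (intro inj_onI) (metis Suc_eq_plus1 atLeastAtMost_iff diff_diff_cancel le_SucI subsetD)
    then have "card ((\<lambda>t. N * k + 1 - t) ` Je e) = card (Je e)" by (rule card_image)
    moreover have "c * real (N * k) = \<kappa> * k / m"
      using assms(2) by (simp add: c_def)
    moreover have "\<kappa> * k / m \<le> D / m" using D by (intro divide_right_mono) auto
    ultimately have "c * real (N * k) \<le> card ((\<lambda>t. N * k + 1 - t) ` Je e)"
      using e(2) by linarith
    moreover have "(\<lambda>t. N * k + 1 - t) ` Je e \<subseteq> {1..N * k}"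
      using JeN by (fastforce)
    ultimately show ?thesis using ind e(1) by blast
  qed
  note step = this
  have "\<exists>\<^sub>F n in sequentially. \<exists>e\<in>E. \<exists>J\<subseteq>{1..n}. c * real n \<le> real (card J) \<and>
      indep_on H F (\<lambda>b. if b then near e else far e) UNIV J"
    unfolding frequently_sequentially
  proof (rule allI)
    fix n0
    have "n0 \<le> N * n0" using assms(2) by simp
    then show "\<exists>n\<ge>n0. \<exists>e\<in>E. \<exists>J\<subseteq>{1..n}. c * real n \<le> real (card J) \<and>
      indep_on H F (\<lambda>b. if b then near e else far e) UNIV J"
      using step[of n0] by (intro exI[of _ "N * n0"] conjI)
  qed
  from frequently_bex_finite[OF E(1) this] \<open>c > 0\<close> show ?thesis
    unfolding dense_indep_def by blast
qed

text \<open>A nondegenerate thin continuum may be tiny, so it is first enlarged: expansivity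
  separates it by more than \<open>2 * d\<close>, necessarily backwards, and branching then supplies
  a fat one.\<close>

lemma exists_dense_indep_pair:
  assumes "thin A" "x \<in> A" "y \<in> A" "x \<noteq> y"
  shows "\<exists>P Q. closed P \<and> closed Q \<and> P \<subseteq> H \<and> Q \<subseteq> H \<and> P \<inter> Q = {} \<and>
           dense_indep H F (\<lambda>b. if b then P else Q) UNIV"
proof -
  have A: "A \<subseteq> H" "compact A" "connected A"
    and small: "\<And>n x y. x \<in> A \<Longrightarrow> y \<in> A \<Longrightarrow> dist ((F ^^ n) x) ((F ^^ n) y) \<le> d"
    using assms(1) by (auto simp: thin_def)
  have cov: "H \<subseteq> (\<Union>e\<in>H. ball e (d / 8))" using d_pos by auto
  obtain E where E: "E \<subseteq> H" "finite E" "H \<subseteq> (\<Union>e\<in>E. ball e (d / 8))"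
    by (rule compactE_image[OF compact _ cov]) (rule open_ball, rule that)
  have "(\<Union>e\<in>E. ball e (d / 8)) \<subseteq> (\<Union>e\<in>E. cball e (d / 8))"
    by (intro UN_mono ball_subset_cball order_refl)
  with E(3) have net: "H \<subseteq> (\<Union>e\<in>E. cball e (d / 8))" by (rule subset_trans)
  then have "E \<noteq> {}" using assms(2) A(1) by blast
  obtain n u v where uv: "u \<in> A" "v \<in> A"
    "2 * d < dist ((F ^^ n) u) ((F ^^ n) v) \<or> 2 * d < dist ((G ^^ n) u) ((G ^^ n) v)"
    using expansive[OF A assms(2-4)] by blast
  have "d < dist ((G ^^ n) u) ((G ^^ n) v)"
    using uv(3) small[OF uv(1,2), of n] d_pos by linarith
  then obtain C where C: "thin C" "fat C"
    using branching[OF assms(1) uv(1,2) _ net] by blast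
  obtain N where N: "\<forall>A. thin A \<longrightarrow> fat A \<longrightarrow> (\<exists>n\<le>N. \<exists>u\<in>A. \<exists>v\<in>A. d < dist ((G ^^ n) u) ((G ^^ n) v))"
    using uniform_growth by (rule exE)
  have "\<exists>n\<le>Suc N. \<exists>u\<in>A. \<exists>v\<in>A. d < dist ((G ^^ n) u) ((G ^^ n) v)" if "thin A" "fat A" for A
    using N that le_SucI by blast
  from shattered_imp_dense_indep[OF this _ E(2) \<open>E \<noteq> {}\<close> net C]
  obtain e where "dense_indep H F (\<lambda>b. if b then near e else far e) UNIV" by auto
  moreover have "near e \<subseteq> H" "far e \<subseteq> H" by (auto simp: near_def far_def)
  ultimately show ?thesis using near_far[of e] by blast
qed

end

subsection \<open>Passage to the iterate that fixes the chaotic continuum\<close>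

text \<open>Times for the iterate become multiples of \<open>m\<close> for the map itself. The extra
  factor 2 in the density absorbs the rounding of \<open>n div m\<close>.\<close>

lemma positive_density_dilation:
  assumes "c > 0" "\<And>L. c * real L \<le> real (card (I \<inter> {1..L}))" "m \<ge> 1"
  shows "positive_density ((*) m ` I)"
proof -
  have "ereal (c / (2 * m)) \<le> liminf (\<lambda>n. ereal (real (card ((*) m ` I \<inter> {1..n})) / real n))"
  proof (rule Liminf_bounded, rule eventually_sequentiallyI)
    fix n assume n: "2 * m \<le> n"
    then have "n > 0" using assms(3) by linarith
    have "(*) m ` (I \<inter> {1..n div m}) \<subseteq> (*) m ` I \<inter> {1..n}"
    proof (intro subsetI IntI)
      fix j assume "j \<in> (*) m ` (I \<inter> {1..n div m})"
      then obtain i where "j = m * i" "i \<in> I \<inter> {1..n div m}" by blast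
      then have i: "j = m * i" "i \<in> I" "1 \<le> i" "i \<le> n div m" by auto
      then have "m * i \<le> m * (n div m)" by simp
      also have "\<dots> \<le> n" by simp
      finally show "j \<in> {1..n}" using i assms(3) by simp
      show "j \<in> (*) m ` I" using i by blast
    qed
    then have "card ((*) m ` (I \<inter> {1..n div m})) \<le> card ((*) m ` I \<inter> {1..n})"
      by (intro card_mono) auto
    moreover have "card ((*) m ` (I \<inter> {1..n div m})) = card (I \<inter> {1..n div m})"
      using assms(3) by (intro card_image inj_onI) auto
    ultimately have "c * real (n div m) \<le> card ((*) m ` I \<inter> {1..n})"
      using assms(2)[of "n div m"] by linarith
    moreover have "c * (n / (2 * m)) \<le> c * real (n div m)"
    proof (rule mult_left_mono)
      have "n < m * (n div m) + m"
        using mod_less_divisor[of m n] mult_div_mod_eq[of m n] assms(3) by linarith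
      moreover have "2 * m \<le> n" by (rule n)
      ultimately have "n \<le> 2 * (m * (n div m))" by linarith
      then have "real n \<le> 2 * (real m * real (n div m))"
        by (metis of_nat_le_iff of_nat_mult of_nat_numeral)
      then show "real n / real (2 * m) \<le> real (n div m)"
        using assms(3) by (simp add: field_simps)
    qed (use assms(1) in simp)
    ultimately have "c * (n / (2 * m)) \<le> card ((*) m ` I \<inter> {1..n})" by linarith
    then have "c / (2 * m) * n \<le> card ((*) m ` I \<inter> {1..n})" by simp
    then show "ereal (c / real (2 * m)) \<le> ereal (real (card ((*) m ` I \<inter> {1..n})) / real n)"
      using \<open>n > 0\<close> by (simp add: pos_le_divide_eq)
  qed
  moreover have "0 < ereal (c / (2 * m))" using assms(1,3) by simp
  ultimately show ?thesis unfolding positive_density_def by (rule less_le_trans[rotated])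
qed

lemma homeomorphism_funpow_restrict:
  assumes "homeomorphism X X g g'" "H \<subseteq> X" "(g ^^ m) ` H = H"
  shows "homeomorphism H H (g ^^ m) (g' ^^ m)"
proof -
  have g: "g ` X \<subseteq> X" "continuous_on X g" "g' ` X \<subseteq> X" "continuous_on X g'"
    and inv: "\<And>x. x \<in> X \<Longrightarrow> g' (g x) = x" "\<And>x. x \<in> X \<Longrightarrow> g (g' x) = x"
    using assms(1) by (auto simp: homeomorphism_def)
  have 1: "(g' ^^ m) ((g ^^ m) x) = x" if "x \<in> X" for x
    by (rule funpow_left_inverse[OF g(1) inv(1) that])
  have 2: "(g ^^ m) ((g' ^^ m) x) = x" if "x \<in> X" for x
    by (rule funpow_left_inverse[OF g(3) inv(2) that])
  have "(g' ^^ m) ` H = (g' ^^ m) ` (g ^^ m) ` H" using assms(3) by simp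
  also have "\<dots> = (\<lambda>x. x) ` H"
    unfolding image_image by (rule image_cong) (use 1 assms(2) in auto)
  finally have "(g' ^^ m) ` H = H" by simp
  moreover have "continuous_on H (g ^^ m)" "continuous_on H (g' ^^ m)"
    using continuous_on_funpow[OF g(1,2)] continuous_on_funpow[OF g(3,4)] assms(2)
      continuous_on_subset by blast+
  ultimately show ?thesis
    unfolding homeomorphism_def using 1 2 assms(2,3) by blast
qed

text \<open>This transfers expansivity to a power: an iterate of \<open>g\<close> is an iterate of
  \<open>g ^^ m\<close> followed by fewer than \<open>m\<close> steps, so points separated by
  \<open>c\<close> under \<open>g\<close> are at least \<open>\<delta>\<close> apart under the
  power.\<close>

lemma uniform_modulus_funpow:
  fixes X :: "'a::metric_space set"
  assumes "compact X" "continuous_on X g" "g ` X \<subseteq> X" "c > 0"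
  shows "\<exists>\<delta>>0. \<forall>r<m. \<forall>x\<in>X. \<forall>y\<in>X. dist x y < \<delta> \<longrightarrow> dist ((g ^^ r) x) ((g ^^ r) y) < c"
proof (induction m)
  case 0
  then show ?case by (intro exI[of _ 1]) simp
next
  case (Suc m)
  then obtain \<delta> where \<delta>: "\<delta> > 0"
    "\<And>r x y. r < m \<Longrightarrow> x \<in> X \<Longrightarrow> y \<in> X \<Longrightarrow> dist x y < \<delta> \<Longrightarrow> dist ((g ^^ r) x) ((g ^^ r) y) < c"
    by blast
  have "uniformly_continuous_on X (g ^^ m)"
    using compact_uniformly_continuous[OF continuous_on_funpow[OF assms(3,2)] assms(1)] .
  then obtain \<delta>' where \<delta>': "\<delta>' > 0"
    "\<And>x y. x \<in> X \<Longrightarrow> y \<in> X \<Longrightarrow> dist x y < \<delta>' \<Longrightarrow> dist ((g ^^ m) x) ((g ^^ m) y) < c"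
    unfolding uniformly_continuous_on_def using assms(4) by metis
  show ?case
    by (intro exI[of _ "min \<delta> \<delta>'"]) (use \<delta> \<delta>' in \<open>auto simp: less_Suc_eq\<close>)
qed

text \<open>Passing to the inverse only exchanges the two alternatives, so both directions are
  handled as one map \<open>g\<close> with inverse \<open>g'\<close>.\<close>

lemma cw_expansive_dir_map:
  fixes X :: "'a::metric_space set"
  assumes "self_homeomorphism X f" "cw_expansive X f" "g = dir_map X f \<sigma>"
  obtains g' c where "homeomorphism X X g g'" "c > 0"
    "\<And>A. subcontinuum X A \<Longrightarrow> nondegenerate A \<Longrightarrow>
       \<exists>n. c < diameter ((g ^^ n) ` A) \<or> c < diameter ((g' ^^ n) ` A)"
proof -
  obtain c where c: "c > 0"
    "\<And>A. subcontinuum X A \<Longrightarrow> nondegenerate A \<Longrightarrow> \<exists>n::int. c < diameter (int_iterate X f n ` A)"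
    using assms(2) unfolding cw_expansive_def by blast
  have *: "\<exists>n. c < diameter ((f ^^ n) ` A) \<or> c < diameter ((inv_into X f ^^ n) ` A)"
    if A: "subcontinuum X A" "nondegenerate A" for A
  proof -
    obtain n :: int where "c < diameter (int_iterate X f n ` A)" using c(2)[OF A] by blast
    then show ?thesis by (cases "0 \<le> n") (auto simp: int_iterate_def)
  qed
  have hom: "homeomorphism X X f (inv_into X f)"
    using assms(1) by (simp add: self_homeomorphism_def)
  show thesis
  proof (cases \<sigma>)
    case Stable
    then show ?thesis using that[of "inv_into X f" c] hom c(1) * assms(3) by simp
  next
    case Unstable
    then show ?thesis
      using that[of f c] homeomorphism_symD[OF hom] c(1) * assms(3) by (simp add: disj_commute)
  qed
qed

lemma periodic_set_dir_map:
  assumes "self_homeomorphism X f" "periodic_set f H" "H \<subseteq> X" "g = dir_map X f \<sigma>"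
  obtains m where "m \<ge> 1" "(g ^^ m) ` H = H"
proof -
  obtain m where m: "m \<ge> 1" "(f ^^ m) ` H = H"
    using assms(2) unfolding periodic_set_def by blast
  have hom: "homeomorphism X X f (inv_into X f)"
    using assms(1) by (simp add: self_homeomorphism_def)
  have "(inv_into X f ^^ m) ` H = H"
    using homeomorphism_funpow_restrict[OF hom assms(3) m(2)] by (simp add: homeomorphism_def)
  then show thesis
    using that[of m] m assms(4) by (cases \<sigma>) auto
qed

lemma funpow_mod_div: "(g ^^ n) x = (g ^^ (n mod m)) (((g ^^ m) ^^ (n div m)) x)"
  by (metis comp_apply funpow_add funpow_mult mod_mult_div_eq)

theorem corollary4p2:
  fixes X H :: "'a::metric_space set" and f g :: "'a \<Rightarrow> 'a" and \<sigma> :: direction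
  assumes "continuum X"
    and "self_homeomorphism X f"
    and "cw_expansive X f"
    and "chaotic_continuum X f \<sigma> H"
    and "periodic_set f H"
    and "g = dir_map X f \<sigma>"
  shows "\<exists>Z \<subseteq> H. Cantor_set Z \<and>
    vertically_embedded X f \<sigma> H Z \<and>
    (\<forall>xs. set xs \<subseteq> Z \<longrightarrow> IE_tuple X g xs) \<and>
    (\<forall>k\<ge>1. \<forall>y z :: nat \<Rightarrow> 'a.
       y ` {1..k} \<subseteq> Z \<and> inj_on y {1..k} \<and> z ` {1..k} \<subseteq> Z \<longrightarrow>
       liminf (\<lambda>n. ereal (MAX i\<in>{1..k}. dist ((g ^^ n) (y i)) (z i))) = 0)"
proof -
  have X: "compact X" using assms(1) by (simp add: continuum_def)
  have H: "H \<subseteq> X" "H \<noteq> {}" "compact H"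
    using assms(4) by (auto simp: chaotic_continuum_def subcontinuum_def continuum_def)
  obtain g' c where hom: "homeomorphism X X g g'" and "c > 0" and
    cw: "\<And>A. subcontinuum X A \<Longrightarrow> nondegenerate A \<Longrightarrow>
       \<exists>n. c < diameter ((g ^^ n) ` A) \<or> c < diameter ((g' ^^ n) ` A)"
    using cw_expansive_dir_map[OF assms(2,3,6)] by metis
  obtain m where m: "m \<ge> 1" "(g ^^ m) ` H = H"
    using periodic_set_dir_map[OF assms(2,5) H(1) assms(6)] by metis
  define F G where "F = g ^^ m" and "G = g' ^^ m"
  have g: "g ` X \<subseteq> X" "continuous_on X g" "g' ` X \<subseteq> X" "continuous_on X g'"
    using hom by (auto simp: homeomorphism_def)
  have homH: "homeomorphism H H F G"
    unfolding F_def G_def by (rule homeomorphism_funpow_restrict[OF hom H(1) m(2)])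
  have FH: "F ` H \<subseteq> H" "continuous_on H F" "G ` H \<subseteq> H"
    using homH by (auto simp: homeomorphism_def)
  obtain \<delta>1 where \<delta>1: "\<delta>1 > 0"
    "\<forall>r<m. \<forall>x\<in>X. \<forall>y\<in>X. dist x y < \<delta>1 \<longrightarrow> dist ((g ^^ r) x) ((g ^^ r) y) < c"
    using uniform_modulus_funpow[OF X g(2,1) \<open>c > 0\<close>] by blast
  obtain \<delta>2 where \<delta>2: "\<delta>2 > 0"
    "\<forall>r<m. \<forall>x\<in>X. \<forall>y\<in>X. dist x y < \<delta>2 \<longrightarrow> dist ((g' ^^ r) x) ((g' ^^ r) y) < c"
    using uniform_modulus_funpow[OF X g(4,3) \<open>c > 0\<close>] by blast
  \<comment> \<open>Division by 4 puts \<open>2 * d\<close> strictly below both moduli.\<close>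
  define d where "d = min \<delta>1 \<delta>2 / 4"
  have d: "d > 0" "2 * d < \<delta>1" "2 * d < \<delta>2" using \<delta>1(1) \<delta>2(1) by (auto simp: d_def min_def)
  interpret cw_system H F G d
  proof
    fix A x y assume A: "A \<subseteq> H" "compact A" "connected A" "x \<in> A" "y \<in> A" "x \<noteq> y"
    have "subcontinuum X A" "nondegenerate A"
      using A H(1) by (auto simp: subcontinuum_def continuum_def nondegenerate_def)
    then obtain n where n: "c < diameter ((g ^^ n) ` A) \<or> c < diameter ((g' ^^ n) ` A)"
      using cw by blast
    have AX: "A \<subseteq> X" using A(1) H(1) by blast
    have bd: "bounded ((h ^^ n) ` A)" if "h ` X \<subseteq> X" "continuous_on X h" for h
      using compact_continuous_image[OF continuous_on_subset[OF continuous_on_funpow[OF that] AX] A(2)]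
      by (rule compact_imp_bounded)
    from n show "\<exists>n. \<exists>u\<in>A. \<exists>v\<in>A. 2 * d < dist ((F ^^ n) u) ((F ^^ n) v) \<or>
       2 * d < dist ((G ^^ n) u) ((G ^^ n) v)"
    proof
      assume "c < diameter ((g ^^ n) ` A)"
      then obtain u v where uv: "u \<in> A" "v \<in> A" "c < dist ((g ^^ n) u) ((g ^^ n) v)"
        using diameter_lower_bounded[OF bd[OF g(1,2)] \<open>c > 0\<close>] by blast
      have "2 * d < dist ((F ^^ (n div m)) u) ((F ^^ (n div m)) v)"
      proof (rule ccontr)
        assume "\<not> ?thesis"
        then have "dist ((F ^^ (n div m)) u) ((F ^^ (n div m)) v) < \<delta>1" using d(2) by simp
        moreover have "(F ^^ (n div m)) u \<in> X" "(F ^^ (n div m)) v \<in> X"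
          using funpow_invariant[OF FH(1)] uv(1,2) A(1) H(1) by blast+
        moreover have "n mod m < m" using m(1) by simp
        ultimately show False
          using \<delta>1(2) uv(3) funpow_mod_div[where g = g and m = m and n = n] unfolding F_def
          by (metis less_asym)
      qed
      then show ?thesis using uv(1,2) by blast
    next
      assume "c < diameter ((g' ^^ n) ` A)"
      then obtain u v where uv: "u \<in> A" "v \<in> A" "c < dist ((g' ^^ n) u) ((g' ^^ n) v)"
        using diameter_lower_bounded[OF bd[OF g(3,4)] \<open>c > 0\<close>] by blast
      have "2 * d < dist ((G ^^ (n div m)) u) ((G ^^ (n div m)) v)"
      proof (rule ccontr)
        assume "\<not> ?thesis"
        then have "dist ((G ^^ (n div m)) u) ((G ^^ (n div m)) v) < \<delta>2" using d(3) by simp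
        moreover have "(G ^^ (n div m)) u \<in> X" "(G ^^ (n div m)) v \<in> X"
          using funpow_invariant[OF FH(3)] uv(1,2) A(1) H(1) by blast+
        moreover have "n mod m < m" using m(1) by simp
        ultimately show False
          using \<delta>2(2) uv(3) funpow_mod_div[where g = g' and m = m and n = n] unfolding G_def
          by (metis less_asym)
      qed
      then show ?thesis using uv(1,2) by blast
    qed
  qed (use H(3) homH d(1) in auto)
  have asym: "\<forall>\<^sub>F n in sequentially. dist ((g ^^ n) u) ((g ^^ n) v) < e"
    if A: "A \<in> closed_connected_subsets H" "(\<lambda>n. diameter ((g ^^ n) ` A)) \<longlonglongrightarrow> 0"
      and "u \<in> A" "v \<in> A" "e > 0" for A u v e
    using order_tendstoD(2)[OF A(2) \<open>e > 0\<close>]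
  proof (rule eventually_mono)
    fix n assume "diameter ((g ^^ n) ` A) < e"
    moreover have "bounded ((g ^^ n) ` A)"
    proof -
      have "A \<subseteq> H" "closed A" using A(1) by (auto simp: closed_connected_subsets_def)
      then have "compact A" using H(3) by (metis compact_Int_closed inf.absorb_iff2)
      then show ?thesis
        using compact_imp_bounded compact_continuous_image
          continuous_on_subset[OF continuous_on_funpow[OF g(1,2)]] \<open>A \<subseteq> H\<close> H(1)
        by (metis subset_trans)
    qed
    ultimately show "dist ((g ^^ n) u) ((g ^^ n) v) < e"
      using diameter_bounded_bound[of "(g ^^ n) ` A" "(g ^^ n) u" "(g ^^ n) v"] \<open>u \<in> A\<close> \<open>v \<in> A\<close>
      by simp
  qed
  \<comment> \<open>Sensitivity gives \<open>H\<close> a second point, so a dense set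
    \<open>V_set X f \<sigma> x H\<close> is not contained in \<open>{x}\<close> and supplies a
    nondegenerate contracted continuum. A late image of it is thin.\<close>
  obtain A x y where A: "thin A" "x \<in> A" "y \<in> A" "x \<noteq> y"
  proof -
    obtain \<tau> where \<tau>: "\<tau> > 0" "\<forall>x\<in>H. \<forall>U. openin (top_of_set X) U \<and> x \<in> U \<longrightarrow>
        (\<exists>y\<in>U \<inter> H. liminf (\<lambda>n. ereal (dist ((g ^^ n) x) ((g ^^ n) y))) \<ge> ereal \<tau>)"
      using assms(4,6) unfolding chaotic_continuum_def by blast
    obtain x where x: "x \<in> H" using H(2) by blast
    then have "openin (top_of_set X) X \<and> x \<in> X" using H(1) by auto
    then obtain y where y: "y \<in> H" "liminf (\<lambda>n. ereal (dist ((g ^^ n) x) ((g ^^ n) y))) \<ge> ereal \<tau>"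
      using \<tau>(2) x by blast
    have "x \<noteq> y" using y(2) \<tau>(1) by (auto simp: Liminf_const)
    have "H \<subseteq> closure (V_set X f \<sigma> x H)"
      using assms(4) x by (simp add: chaotic_continuum_def)
    then have "\<not> V_set X f \<sigma> x H \<subseteq> {x}"
      using y(1) \<open>x \<noteq> y\<close> by (metis closed_singleton closure_minimal insertE empty_iff subset_iff)
    then obtain v where "v \<in> V_set X f \<sigma> x H" "v \<noteq> x" by blast
    then obtain A where A: "A \<in> closed_connected_subsets H" "x \<in> A" "v \<in> A"
      "(\<lambda>n. diameter ((g ^^ n) ` A)) \<longlonglongrightarrow> 0"
      using assms(6) unfolding V_set_def by blast
    have "A \<subseteq> H" "closed A" "connected A" using A(1) by (auto simp: closed_connected_subsets_def)
    then have "compact A" using H(3) by (metis compact_Int_closed inf.absorb_iff2)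
    have bd: "bounded ((g ^^ n) ` A)" for n
      using compact_imp_bounded[OF compact_continuous_image[OF
          continuous_on_subset[OF continuous_on_funpow[OF g(1,2)]] \<open>compact A\<close>]]
        \<open>A \<subseteq> H\<close> H(1) by blast
    obtain N where N: "\<And>n. n \<ge> N \<Longrightarrow> diameter ((g ^^ n) ` A) < d"
      using order_tendstoD(2)[OF A(4) d(1)] unfolding eventually_sequentially by blast
    have "continuous_on A (F ^^ N)"
      using continuous_on_subset[OF continuous_on_funpow[OF FH(1,2)] \<open>A \<subseteq> H\<close>] .
    then have "compact ((F ^^ N) ` A)" "connected ((F ^^ N) ` A)"
      using compact_continuous_image connected_continuous_image \<open>compact A\<close> \<open>connected A\<close> by blast+
    moreover have "(F ^^ N) ` A \<subseteq> H" using funpow_invariant[OF FH(1)] \<open>A \<subseteq> H\<close> by blast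
    moreover have "dist ((F ^^ n) ((F ^^ N) a)) ((F ^^ n) ((F ^^ N) b)) \<le> d" if "a \<in> A" "b \<in> A" for n a b
    proof -
      have eq: "(F ^^ n) ((F ^^ N) z) = (g ^^ (m * (n + N))) z" for z
      proof -
        have "(F ^^ n) ((F ^^ N) z) = (F ^^ (n + N)) z" by (simp add: funpow_add)
        then show ?thesis unfolding F_def funpow_mult .
      qed
      have "1 * N \<le> m * (n + N)" using m(1) by (intro mult_le_mono) auto
      then have "N \<le> m * (n + N)" by simp
      then show ?thesis
        unfolding eq using N[of "m * (n + N)"] that
          diameter_bounded_bound[OF bd[of "m * (n + N)"], of "(g ^^ (m * (n + N))) a" "(g ^^ (m * (n + N))) b"]
        by simp
    qed
    ultimately have "thin ((F ^^ N) ` A)" by (auto simp: thin_def)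
    moreover have "(F ^^ N) x \<noteq> (F ^^ N) v"
      using funpow_G_F[of x N] funpow_G_F[of v N] \<open>v \<noteq> x\<close> A(2,3) \<open>A \<subseteq> H\<close> by (metis subsetD)
    ultimately show thesis using that A(2,3) by blast
  qed
  obtain P Q where PQ: "closed P" "closed Q" "P \<subseteq> H" "Q \<subseteq> H" "P \<inter> Q = {}"
    "dense_indep H F (\<lambda>b. if b then P else Q) UNIV"
    using exists_dense_indep_pair[OF A] by (elim exE conjE) (rule that)
  obtain Z where Z: "Z \<subseteq> H" "Cantor_set Z"
    and IE: "\<forall>xs As. set xs \<subseteq> Z \<longrightarrow> (\<forall>i<length xs. \<exists>e>0. H \<inter> ball (xs ! i) e \<subseteq> As i) \<longrightarrow>
       dense_indep H F As {..<length xs}"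
    and itin: "\<forall>S \<phi> \<epsilon> N. finite S \<longrightarrow> S \<subseteq> Z \<longrightarrow> \<phi> ` S \<subseteq> Z \<longrightarrow> 0 < \<epsilon> \<longrightarrow>
       (\<exists>n\<ge>N. \<forall>y\<in>S. dist ((F ^^ n) y) (\<phi> y) < \<epsilon>)"
    using Cantor_set_of_dense_indep_pair[OF H(3) FH(2,1) PQ] by (elim exE conjE) (rule that)
  have itin_g: "\<exists>n\<ge>N. \<forall>y\<in>S. dist ((g ^^ n) y) (\<phi> y) < \<epsilon>"
    if S: "finite S" "S \<subseteq> Z" "\<phi> ` S \<subseteq> Z" "\<epsilon> > 0" for S \<phi> \<epsilon> and N :: nat
  proof -
    obtain n where n: "n \<ge> N" "\<forall>y\<in>S. dist ((F ^^ n) y) (\<phi> y) < \<epsilon>" using itin[rule_format, OF S, of N] by blast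
    have "1 * N \<le> m * n" using n(1) m(1) by (intro mult_le_mono)
    then have "N \<le> m * n" by simp
    then show ?thesis using n(2) by (intro exI[of _ "m * n"]) (simp add: F_def funpow_mult)
  qed
  have "vertically_embedded X f \<sigma> H Z"
    unfolding vertically_embedded_def
  proof (intro ballI impI, rule ccontr)
    fix x y z assume "y \<in> Z" "z \<in> Z" "y \<noteq> z" and V: "y \<in> V_set X f \<sigma> x H \<and> z \<in> V_set X f \<sigma> x H"
    \<comment> \<open>The path from \<open>y\<close> to \<open>z\<close> through the images of
      \<open>y\<close>, \<open>x\<close> and \<open>z\<close> under \<open>g ^^ n\<close> has four
      pieces, each shorter than \<open>e\<close>.\<close>
    define e where "e = dist y z / 4"
    have "e > 0" using \<open>y \<noteq> z\<close> by (simp add: e_def)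
    obtain A B where "A \<in> closed_connected_subsets H" "x \<in> A" "y \<in> A"
      "(\<lambda>n. diameter ((g ^^ n) ` A)) \<longlonglongrightarrow> 0"
      and "B \<in> closed_connected_subsets H" "x \<in> B" "z \<in> B"
      "(\<lambda>n. diameter ((g ^^ n) ` B)) \<longlonglongrightarrow> 0"
      using V assms(6) unfolding V_set_def by blast
    then have "\<forall>\<^sub>F n in sequentially. dist ((g ^^ n) x) ((g ^^ n) y) < e \<and> dist ((g ^^ n) x) ((g ^^ n) z) < e"
      using asym \<open>e > 0\<close> by (intro eventually_conj) blast+
    then obtain N where N: "\<And>n. n \<ge> N \<Longrightarrow> dist ((g ^^ n) x) ((g ^^ n) y) < e \<and> dist ((g ^^ n) x) ((g ^^ n) z) < e"
      unfolding eventually_sequentially by blast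
    obtain n where n: "n \<ge> N" "dist ((g ^^ n) y) y < e" "dist ((g ^^ n) z) z < e"
      using itin_g[of "{y, z}" "\<lambda>x. x" e N] \<open>y \<in> Z\<close> \<open>z \<in> Z\<close> \<open>e > 0\<close> by auto
    have "dist y z \<le> dist ((g ^^ n) y) y + dist ((g ^^ n) x) ((g ^^ n) y) +
        dist ((g ^^ n) x) ((g ^^ n) z) + dist ((g ^^ n) z) z"
      using dist_triangle3[of y z "(g ^^ n) y"] dist_triangle[of "(g ^^ n) y" z "(g ^^ n) z"]
        dist_triangle3[of "(g ^^ n) y" "(g ^^ n) z" "(g ^^ n) x"] by linarith
    then show False using n N[OF n(1)] by (simp add: e_def)
  qed
  moreover have "IE_tuple X g xs" if xs: "set xs \<subseteq> Z" for xs
    unfolding IE_tuple_def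
  proof (intro allI impI)
    fix As assume As: "length As = length xs \<and>
        (\<forall>i<length xs. openin (top_of_set X) (As ! i) \<and> xs ! i \<in> As ! i)"
    have "\<exists>e>0. H \<inter> ball (xs ! i) e \<subseteq> As ! i" if i: "i < length xs" for i
    proof -
      obtain e where e: "e > 0" "ball (xs ! i) e \<inter> X \<subseteq> As ! i"
        using As i unfolding openin_contains_ball by blast
      then show ?thesis using H(1) by (intro exI[of _ e]) auto
    qed
    then have dens: "dense_indep H F (\<lambda>i. As ! i) {..<length xs}" using IE[rule_format, OF xs, of "\<lambda>i. As ! i"] by blast
    show "has_independence_set_pos_density X g (set As)"
    \<comment> \<open>The passage to an infinite set of times needs a letter. For the empty tuple
      only the empty \<open>J\<close> occurs, and all positive times serve.\<close>
    proof (cases "xs = []")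
      case True
      have "positive_density ((*) 1 ` {1..})"
        by (rule positive_density_dilation[of 1]) (auto simp: Int_absorb1 Int_commute)
      then have "positive_density {1..}" by simp
      moreover have "X \<noteq> {}" using H by blast
      ultimately show ?thesis
        using True As unfolding has_independence_set_pos_density_def
        by (intro exI[of _ "{1..}"]) auto
    next
      case False
      then have "{..<length xs} \<noteq> {}" by auto
      then obtain c I where I: "c > 0" "I \<subseteq> {1..}" "\<And>L. c * real L \<le> real (card (I \<inter> {1..L}))"
        "\<And>J. finite J \<Longrightarrow> J \<subseteq> I \<Longrightarrow> indep_on H F (\<lambda>i. As ! i) {..<length xs} J"
        using dense_indep_infinite[OF dens _ FH(1)] by metis
      have "{x\<in>X. \<forall>j\<in>J. (g ^^ j) x \<in> Y j} \<noteq> {}"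
        if J: "finite J" "J \<subseteq> (*) m ` I" "\<forall>j\<in>J. Y j \<in> set As" for J Y
      proof -
        \<comment> \<open>\<open>J\<close> is pulled back along the injective multiplication by
          \<open>m\<close>, which translates times of \<open>g\<close> into times of
          \<open>F\<close>.\<close>
        define J0 where "J0 = {i\<in>I. m * i \<in> J}"
        have inj: "inj ((*) m)" using m(1) by (auto simp: inj_def)
        have "J0 \<subseteq> (*) m -` J" by (auto simp: J0_def)
        then have "finite J0" using finite_vimageI[OF J(1) inj] finite_subset by blast
        have "\<forall>i\<in>J0. \<exists>l<length xs. As ! l = Y (m * i)"
          using J(3) As by (auto simp: J0_def in_set_conv_nth)
        then obtain w where w: "\<And>i. i \<in> J0 \<Longrightarrow> w i < length xs \<and> As ! w i = Y (m * i)" by metis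
        have "w ` J0 \<subseteq> {..<length xs}" using w by auto
        moreover have "indep_on H F (\<lambda>i. As ! i) {..<length xs} J0"
          using I(4)[OF \<open>finite J0\<close>] by (auto simp: J0_def)
        ultimately obtain x where x: "x \<in> H" "\<And>i. i \<in> J0 \<Longrightarrow> (F ^^ i) x \<in> As ! (w i)"
          using indep_onD by metis
        have "(g ^^ j) x \<in> Y j" if j: "j \<in> J" for j
        proof -
          obtain i where i: "i \<in> I" "j = m * i" using J(2) j by blast
          then have "i \<in> J0" using j by (simp add: J0_def)
          then show ?thesis using x(2)[of i] w[of i] i by (simp add: F_def funpow_mult)
        qed
        then show ?thesis using x(1) H(1) by blast
      qed
      moreover have "(*) m ` I \<subseteq> {1..}" using I(2) m(1) by force
      moreover have "positive_density ((*) m ` I)"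
        by (rule positive_density_dilation[OF I(1,3) m(1)])
      ultimately show ?thesis
        unfolding has_independence_set_pos_density_def by blast
    qed
  qed
  moreover have "liminf (\<lambda>n. ereal (MAX i\<in>{1..k}. dist ((g ^^ n) (y i)) (z i))) = 0"
    if k: "k \<ge> 1" and yz: "y ` {1..k} \<subseteq> Z" "inj_on y {1..k}" "z ` {1..k} \<subseteq> Z"
    for k :: nat and y z :: "nat \<Rightarrow> 'a"
  proof (rule antisym)
    let ?M = "\<lambda>n. MAX i\<in>{1..k}. dist ((g ^^ n) (y i)) (z i)"
    have "0 \<le> ?M n" for n
    proof -
      have "dist ((g ^^ n) (y 1)) (z 1) \<le> ?M n" using k by (intro Max_ge) auto
      then show ?thesis using zero_le_dist order_trans by blast
    qed
    then show "0 \<le> liminf (\<lambda>n. ereal (?M n))" by (intro Liminf_bounded always_eventually) simp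
    show "liminf (\<lambda>n. ereal (?M n)) \<le> 0"
    proof (rule ccontr)
      assume "\<not> ?thesis"
      then have "0 < liminf (\<lambda>n. ereal (?M n))" by (simp only: not_le)
      from ereal_dense2[OF this] obtain r where r: "0 < ereal r" "ereal r < liminf (\<lambda>n. ereal (?M n))"
        by blast
      have "\<forall>\<^sub>F n in sequentially. ereal r < ereal (?M n)" using less_LiminfD[OF r(2)] .
      then obtain N where N: "\<And>n. n \<ge> N \<Longrightarrow> r < ?M n" unfolding eventually_sequentially by auto
      \<comment> \<open>Injectivity of \<open>y\<close> lets the targets be read as a function of
        the points; the targets themselves may repeat.\<close>
      define \<phi> where "\<phi> = z \<circ> inv_into {1..k} y"
      have \<phi>: "\<phi> (y i) = z i" if "i \<in> {1..k}" for i
        using inv_into_f_f[OF yz(2) that] by (simp add: \<phi>_def)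
      have "\<phi> ` y ` {1..k} \<subseteq> Z" using \<phi> yz(3) by auto
      then obtain n where n: "n \<ge> N" "\<forall>u\<in>y ` {1..k}. dist ((g ^^ n) u) (\<phi> u) < r"
        using itin_g[OF _ yz(1), of \<phi> r N] r(1) by auto
      have "?M n < r"
        using n(2) \<phi> k by (subst Max_less_iff) auto
      then show False using N[OF n(1)] by simp
    qed
  qed
  ultimately show ?thesis using Z by blast
qed

end
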